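(* Let $G$ be a connected finite simple graph on $[n]$, and let $\mathcal{S}\in\min(G)$. Then the following equality of ideals holds: $$(J_G:P_{\mathcal{S}})=\sqrt{J_G+\big(g_{A,C,D} : A\in\mathcal{T}(\mathcal{S}) \text{ and } C\amalg D=A_1\big)}.$$
   Context: Let $R=\mathbb{C}[x_1,\dots,x_n,y_1,\dots,y_n]$ and $f_{i,j}=x_iy_j-x_jy_i$. For a simple graph $G$ on $[n]=\{1,\dots,n\}$, the binomial edge ideal is $J_G=(f_{i,j} : \{i,j\}\in E(G),\ i<j)\subset R$. For $W\subseteq[n]$, $G_W$ denotes the induced subgraph on $W$. Cuts. A vertex $i$ is a cut point of a graph $H$ if $H$ has fewer connected components than the graph obtained from $H$ by deleting $i$. A nonempty $\mathcal{S}\subsetneq[n]$ is a minimal $k$-cut of $G$ if $G_{[n]\setminus\mathcal{S}}$ has exactly $k$ connected components and each $i\in\mathcal{S}$ is a cut point of $G_{([n]\setminus\mathcal{S})\cup\{i\}}$. $\min(G)$ is the set of all minimal $k$-cuts of $G$, $k\ge2$, together with $\emptyset$. Primes. For $\mathcal{S}\subseteq[n]$, let $G_1,\dots,G_c$ be the connected components of $G_{[n]\setminus\mathcal{S}}$ and put $P_{\mathcal{S}}=(x_i,y_i : i\in\mathcal{S})+\sum_{t=1}^{c}(f_{i,j} : i<j,\ i,j\in V(G_t))$. For $G$ connected, the minimal primes of $J_G$ are exactly the $P_{\mathcal{S}}$ with $\mathcal{S}\in\min(G)$. Matroid dependencies. For $\mathcal{S}\subseteq[n]$, let $G_1,\dots,G_c$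 be the connected components of the induced subgraph $G_{[n]\setminus\mathcal{S}}$; then $\mathcal{D}(M(\mathcal{S}))$ is the collection of all $B\subseteq[n]$ such that $B\cap\mathcal{S}\ne\emptyset$, or $|B\cap V(G_t)|\ge2$ for some $t\in\{1,\dots,c\}$, or $|B|\ge3$ (the dependent sets of a matroid $M(\mathcal{S})$ of rank at most two on $[n]$). Transversals. For a collection $\Delta$ of subsets of a set, a transversal of $\Delta$ is a subset $A\subseteq\bigcup_{e\in\Delta}e$ with $A\cap e\neq\emptyset$ for all $e\in\Delta$. For $\mathcal{S}\in\min(G)$ let $\Delta_{\mathcal{S}}=\{\mathcal{D}(M(\mathcal{S}'))\setminus\mathcal{D}(M(\mathcal{S})) : \mathcal{S}'\in\min(G)\setminus\{\mathcal{S}\}\}$, whose members are subsets of $\big(\binom{[n]}{1}\cup\binom{[n]}{2}\big)\setminus\mathcal{D}(M(\mathcal{S}))$, and let $\mathcal{T}(\mathcal{S})$ be the set of all transversals of $\Delta_{\mathcal{S}}$. Each $A\in\mathcal{T}(\mathcal{S})$ is uniquely $A=A_1\amalg A_2$ with $A_1\subseteq\binom{[n]}{1}$ and $A_2\subseteq\binom{[n]}{2}$; $A_1$ is identified with a subset of $[n]$. For $A\in\mathcal{T}(\mathcal{S})$ and $A_1=C\amalg D$ (disjoint union, parts possibly empty), $g_{A,C,D}=\prod_{k\in C}x_k\prod_{k\in D}y_k\prod_{\{i,j\}\in A_2}f_{i,j}$ ($f_{i,j}$ is determined up to sign by $\{i,j\}$). *)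

theory Defs
  imports
    Complex_Main
    "HOL-Library.Poly_Mapping"
    "HOL-Algebra.Ideal"
    "HOL-Algebra.Algebraic_Closure_Type"
begin

text \<open>
  The vertex set [n] is the universe of a finite linearly ordered type \<open>'v\<close> with n elements, so a
  graph on [n] is given by its set of edges.
\<close>

definition simple_graph :: "'v set set \<Rightarrow> bool" where
  "simple_graph E \<longleftrightarrow> (\<forall>e\<in>E. card e = 2)"

definition induced_adj :: "'v set set \<Rightarrow> 'v set \<Rightarrow> 'v rel" where
  "induced_adj E W = {(i, j). i \<in> W \<and> j \<in> W \<and> {i, j} \<in> E}"

definition induced_components :: "'v set set \<Rightarrow> 'v set \<Rightarrow> 'v set set" where
  "induced_components E W = W // {(i, j). i \<in> W \<and> j \<in> W \<and> (i, j) \<in> (induced_adj E W)\<^sup>*}"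

definition connected_graph :: "'v set set \<Rightarrow> bool" where
  "connected_graph E \<longleftrightarrow> card (induced_components E UNIV) = 1"

text \<open>\<open>cut_point E W i\<close>: the vertex \<open>i\<close> is a cut point of the induced subgraph on \<open>W\<close>.\<close>

definition cut_point :: "'v set set \<Rightarrow> 'v set \<Rightarrow> 'v \<Rightarrow> bool" where
  "cut_point E W i \<longleftrightarrow>
     i \<in> W \<and> card (induced_components E W) < card (induced_components E (W - {i}))"

definition minimal_cut :: "'v set set \<Rightarrow> nat \<Rightarrow> 'v set \<Rightarrow> bool" where
  "minimal_cut E k S \<longleftrightarrow>
     S \<noteq> {} \<and> S \<subset> UNIV \<and> card (induced_components E (UNIV - S)) = k \<and>
     (\<forall>i\<in>S. cut_point E ((UNIV - S) \<union> {i}) i)"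

definition min_cuts :: "'v set set \<Rightarrow> 'v set set" where
  "min_cuts E = {S. \<exists>k\<ge>2. minimal_cut E k S} \<union> {{}}"

definition dependent_sets :: "'v set set \<Rightarrow> 'v set \<Rightarrow> 'v set set" where
  "dependent_sets E S =
     {B. B \<inter> S \<noteq> {} \<or> (\<exists>V\<in>induced_components E (UNIV - S). card (B \<inter> V) \<ge> 2) \<or> card B \<ge> 3}"

definition transversals :: "'a set set \<Rightarrow> 'a set set" where
  "transversals \<Delta> = {A. A \<subseteq> \<Union>\<Delta> \<and> (\<forall>e\<in>\<Delta>. A \<inter> e \<noteq> {})}"

definition dependency_differences :: "'v set set \<Rightarrow> 'v set \<Rightarrow> 'v set set set" where
  "dependency_differences E S =
     {dependent_sets E S' - dependent_sets E S | S'. S' \<in> min_cuts E - {S}}"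

definition cut_transversals :: "'v set set \<Rightarrow> 'v set \<Rightarrow> 'v set set set" where
  "cut_transversals E S = transversals (dependency_differences E S)"

definition singleton_part :: "'v set set \<Rightarrow> 'v set" where
  "singleton_part A = {k. {k} \<in> A}"

definition pair_part :: "'v set set \<Rightarrow> 'v set set" where
  "pair_part A = {e \<in> A. card e = 2}"

definition ideal_quotient :: "('a, 'b) ring_scheme \<Rightarrow> 'a set \<Rightarrow> 'a set \<Rightarrow> 'a set" where
  "ideal_quotient R I J = {r \<in> carrier R. \<forall>a\<in>J. r \<otimes>\<^bsub>R\<^esub> a \<in> I}"

definition ideal_radical :: "('a, 'b) ring_scheme \<Rightarrow> 'a set \<Rightarrow> 'a set" where
  "ideal_radical R I = {r \<in> carrier R. \<exists>k::nat. k > 0 \<and> r [^]\<^bsub>R\<^esub> k \<in> I}"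

text \<open>
  Polynomials over the complex numbers in the indeterminates \<open>Inl i\<close> (standing for \<open>x\<^sub>i\<close>) and
  \<open>Inr i\<close> (standing for \<open>y\<^sub>i\<close>): finitely supported maps from monomials to coefficients, a monomial
  being a finitely supported map from indeterminates to exponents.
\<close>

type_synonym 'v xy_poly = "('v + 'v \<Rightarrow>\<^sub>0 nat) \<Rightarrow>\<^sub>0 complex"

abbreviation xy_ring :: "'v xy_poly ring" where
  "xy_ring \<equiv> ring_of_type_algebra"

definition xvar :: "'v \<Rightarrow> 'v xy_poly" where
  "xvar i = Poly_Mapping.single (Poly_Mapping.single (Inl i) 1) 1"

definition yvar :: "'v \<Rightarrow> 'v xy_poly" where
  "yvar i = Poly_Mapping.single (Poly_Mapping.single (Inr i) 1) 1"

definition minor :: "'v \<Rightarrow> 'v \<Rightarrow> 'v xy_poly" where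
  "minor i j = xvar i * yvar j - xvar j * yvar i"

definition binomial_edge_ideal :: "'v::{finite,linorder} set set \<Rightarrow> 'v xy_poly set" where
  "binomial_edge_ideal E = Idl\<^bsub>xy_ring\<^esub> {minor i j | i j. {i, j} \<in> E \<and> i < j}"

text \<open>
  The sum over the components of the ideals of minors is the ideal generated by the union of
  their generators.
\<close>

definition cut_prime :: "'v::{finite,linorder} set set \<Rightarrow> 'v set \<Rightarrow> 'v xy_poly set" where
  "cut_prime E S =
     Idl\<^bsub>xy_ring\<^esub> (xvar ` S \<union> yvar ` S) <+>\<^bsub>xy_ring\<^esub>
     Idl\<^bsub>xy_ring\<^esub> (\<Union>V\<in>induced_components E (UNIV - S). {minor i j | i j. i < j \<and> i \<in> V \<and> j \<in> V})"

text \<open>For a pair \<open>e\<close> of vertices, the sign of its minor is fixed by listing the smaller vertex first.\<close>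

definition transversal_poly ::
    "'v::{finite,linorder} set set \<Rightarrow> 'v set \<Rightarrow> 'v set \<Rightarrow> 'v xy_poly" where
  "transversal_poly A C D =
     (\<Prod>k\<in>C. xvar k) * (\<Prod>k\<in>D. yvar k) * (\<Prod>e\<in>pair_part A. minor (Min e) (Max e))"

end

theory Submission
  imports Defs "HOL-Library.Product_Lexorder"
begin

text \<open>
  Each \<open>P\<^sub>S\<close> is the kernel of a monomial substitution into a polynomial ring, hence prime. For a
  vertex \<open>v\<close>, let \<open>G\<^sub>v\<close> be \<open>G\<close> with the neighbourhood of \<open>v\<close> completed; then
  \<open>J(G) = J(G\<^sub>v) \<inter> ((x\<^sub>v, y\<^sub>v) + J(G - v))\<close>, and iterating this writes \<open>J(G)\<close> as an intersection of
  ideals \<open>P\<^sub>S\<close>, where the minimal cuts \<open>S\<close> suffice. Since these \<open>P\<^sub>S\<close> are pairwise incomparable, the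
  colon ideal is the intersection of the \<open>P\<^sub>S\<^sub>'\<close> with \<open>S' \<noteq> S\<close>. A power of an element of that
  intersection is a combination of products of generators, one from each \<open>P\<^sub>S\<^sub>'\<close>; such a product
  lies in \<open>J(G)\<close> if one of its factors lies in \<open>P\<^sub>S\<close>, and is divisible by some \<open>g\<close> of a transversal
  otherwise.
\<close>

section \<open>Ideals as spans\<close>

text \<open>The ring is a module over itself and its submodules are its ideals, so facts about
  module spans serve as facts about generated ideals.\<close>

abbreviation ideal_span :: "'a::comm_ring_1 set \<Rightarrow> 'a set" where
  "ideal_span \<equiv> Modules.module.span (*)"

lemma module_mult: "Modules.module ((*) :: 'a::comm_ring_1 \<Rightarrow> 'a \<Rightarrow> 'a)"
  by unfold_locales (simp_all add: algebra_simps)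

lemmas ideal_span_mono = module.span_mono[OF module_mult]
lemmas ideal_span_base = module.span_base[OF module_mult]
lemmas ideal_span_superset = module.span_superset[OF module_mult]
lemmas ideal_span_zero = module.span_zero[OF module_mult]
lemmas ideal_span_add = module.span_add[OF module_mult]
lemmas ideal_span_scale = module.span_scale[OF module_mult]
lemmas ideal_span_neg = module.span_neg[OF module_mult]
lemmas ideal_span_diff = module.span_diff[OF module_mult]
lemmas ideal_span_minimal = module.span_minimal[OF module_mult]
lemmas ideal_span_span = module.span_span[OF module_mult]
lemmas ideal_span_Un = module.span_Un[OF module_mult]
lemmas ideal_subspace_def = module.subspace_def[OF module_mult]
lemmas ideal_span_induct = module.span_induct_alt[OF module_mult, consumes 1, case_names base step]

lemma ideal_span_mult_right: "a \<in> ideal_span G \<Longrightarrow> a * b \<in> ideal_span G"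
  using ideal_span_scale[of a G b] by (simp add: mult.commute)

lemma ideal_span_subset_iff: "ideal_span G \<subseteq> ideal_span K \<longleftrightarrow> G \<subseteq> ideal_span K"
  by (metis order_trans ideal_span_mono ideal_span_span ideal_span_superset)

lemma ideal_span_dvd: "a \<in> ideal_span G \<Longrightarrow> a dvd b \<Longrightarrow> b \<in> ideal_span G"
  by (auto elim!: dvdE intro: ideal_span_mult_right)

lemma ideal_span_mult:
  assumes "a \<in> ideal_span G" and "b \<in> ideal_span K"
  shows "a * b \<in> ideal_span {x * y | x y. x \<in> G \<and> y \<in> K}" (is "_ \<in> ideal_span ?Z")
proof -
  have *: "x * b \<in> ideal_span ?Z" if "x \<in> G" for x
    using assms(2)
  proof (induction rule: ideal_span_induct)
    case base
    then show ?case by (simp add: ideal_span_zero)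
  next
    case (step c y z)
    have "c * (x * y) \<in> ideal_span ?Z"
      using that step by (intro ideal_span_scale ideal_span_base) auto
    then have "c * (x * y) + x * z \<in> ideal_span ?Z"
      using step by (intro ideal_span_add)
    also have "c * (x * y) + x * z = x * (c * y + z)"
      by (simp add: algebra_simps)
    finally show ?case .
  qed
  show ?thesis
    using assms(1)
  proof (induction rule: ideal_span_induct)
    case base
    then show ?case by (simp add: ideal_span_zero)
  next
    case (step c x z)
    then have "c * (x * b) + z * b \<in> ideal_span ?Z"
      using *[of x] by (simp add: ideal_span_add ideal_span_scale)
    also have "c * (x * b) + z * b = (c * x + z) * b"
      by (simp add: algebra_simps)
    finally show ?case .
  qed
qed

text \<open>One factor \<open>r\<close> is spent on each member of \<open>H\<close>; a product of
  combinations of generators expands into products with one generator from each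
  \<open>G s\<close>.\<close>

lemma power_card_in_ideal_span_prod:
  assumes "finite H" and "\<And>s. s \<in> H \<Longrightarrow> r \<in> ideal_span (G s)"
  shows "r ^ card H \<in> ideal_span {\<Prod>s\<in>H. g s | g. \<forall>s\<in>H. g s \<in> G s}"
  using assms
proof (induction H rule: finite_induct)
  case empty
  then show ?case by (simp add: ideal_span_base)
next
  case (insert t H)
  let ?K = "\<lambda>H. {\<Prod>s\<in>H. g s | g. \<forall>s\<in>H. g s \<in> G s}"
  have "r * r ^ card H \<in> ideal_span {x * y | x y. x \<in> G t \<and> y \<in> ?K H}"
    using insert by (intro ideal_span_mult) auto
  also have "{x * y | x y. x \<in> G t \<and> y \<in> ?K H} \<subseteq> ?K (insert t H)"
  proof clarify
    fix x g
    assume "x \<in> G t" and "\<forall>s\<in>H. g s \<in> G s"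
    moreover have "x * (\<Prod>s\<in>H. g s) = (\<Prod>s\<in>insert t H. (g(t := x)) s)"
    proof -
      have "prod g H = prod (g(t := x)) H"
        using insert(2) by (intro prod.cong) auto
      then show ?thesis
        using insert(1,2) by simp
    qed
    ultimately show "\<exists>g'. x * (\<Prod>s\<in>H. g s) = (\<Prod>s\<in>insert t H. g' s) \<and> (\<forall>s\<in>insert t H. g' s \<in> G s)"
      using insert(2) by (intro exI[of _ "g(t := x)"]) auto
  qed
  then have "ideal_span {x * y | x y. x \<in> G t \<and> y \<in> ?K H} \<subseteq> ideal_span (?K (insert t H))"
    by (rule ideal_span_mono)
  finally show ?case
    using insert(1,2) by simp
qed

section \<open>The record-based polynomial ring and its generated ideals\<close>

lemma xy_ring_simps [simp]:
  "carrier xy_ring = UNIV"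
  "a \<otimes>\<^bsub>xy_ring\<^esub> b = a * b" "a \<oplus>\<^bsub>xy_ring\<^esub> b = a + b" "\<one>\<^bsub>xy_ring\<^esub> = 1" "\<zero>\<^bsub>xy_ring\<^esub> = 0"
  by (simp_all add: ring_of_type_algebra_def)

lemma xy_ring_pow [simp]: "a [^]\<^bsub>xy_ring\<^esub> (k::nat) = a ^ k"
  by (induction k) (simp_all add: Group.nat_pow_def mult.commute)

text \<open>Each side is the least ideal containing \<open>G\<close> in its own formalization, and
  each is an ideal in the sense of the other; later arguments work with spans only.\<close>

lemma genideal_xy_ring: "Idl\<^bsub>xy_ring\<^esub> G = ideal_span G"
proof -
  interpret R: cring "xy_ring :: 'a xy_poly ring"
    by (rule cring_from_type_algebra)
  have neg: "\<ominus>\<^bsub>xy_ring\<^esub> a = - a" for a :: "'a xy_poly"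
    by (rule R.minus_equality) simp_all
  have "subgroup (ideal_span G) (add_monoid xy_ring)"
  proof (rule R.add.subgroupI)
    show "ideal_span G \<noteq> {}"
      using ideal_span_zero[of G] by blast
    show "\<ominus>\<^bsub>xy_ring\<^esub> a \<in> ideal_span G" if "a \<in> ideal_span G" for a
      using ideal_span_neg[OF that] by (simp only: neg)
  qed (simp_all add: ideal_span_add)
  then have "ideal (ideal_span G) xy_ring"
    by (rule idealI[OF R.ring_axioms])
      (simp_all add: ideal_span_scale ideal_span_mult_right)
  then have "Idl\<^bsub>xy_ring\<^esub> G \<subseteq> ideal_span G"
    by (intro R.genideal_minimal ideal_span_superset)
  moreover interpret I: ideal "Idl\<^bsub>xy_ring\<^esub> G" xy_ring
    by (rule R.genideal_ideal) simp
  have "Modules.module.subspace (*) (Idl\<^bsub>xy_ring\<^esub> G)"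
    using I.zero_closed I.a_closed I.I_l_closed by (auto simp: ideal_subspace_def)
  then have "ideal_span G \<subseteq> Idl\<^bsub>xy_ring\<^esub> G"
    using R.genideal_self[of G] by (intro ideal_span_minimal) auto
  ultimately show ?thesis by blast
qed

lemma set_add_xy_ring: "ideal_span G <+>\<^bsub>xy_ring\<^esub> ideal_span K = ideal_span (G \<union> K)"
  by (auto simp: set_add_def' ideal_span_Un)

section \<open>Substitution in polynomials\<close>

lemma poly_mapping_induct [case_names zero single add]:
  fixes p :: "'k \<Rightarrow>\<^sub>0 'c::comm_monoid_add"
  assumes "P 0" and "\<And>m c. P (Poly_Mapping.single m c)" and "\<And>p q. P p \<Longrightarrow> P q \<Longrightarrow> P (p + q)"
  shows "P p"
proof (induction p rule: update_induct)
  case const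
  then show ?case using assms(1) by simp
next
  case (update f a b)
  have "Poly_Mapping.update a b f = f + Poly_Mapping.single a b"
    using update(1) by (intro poly_mapping_eqI)
      (auto simp: lookup_update lookup_add lookup_single when_def in_keys_iff)
  with assms update show ?case by metis
qed

text \<open>Nothing multiplicative is built in, so the same extension serves for substitutions and
  for the merely additive lifting \<open>\<psi>\<close> of toric monomials.\<close>

definition lin_ext :: "('k \<Rightarrow> 'c \<Rightarrow> 'r) \<Rightarrow> ('k \<Rightarrow>\<^sub>0 'c::zero) \<Rightarrow> 'r::comm_monoid_add" where
  "lin_ext h p = (\<Sum>m\<in>Poly_Mapping.keys p. h m (Poly_Mapping.lookup p m))"

lemma lin_ext_zero [simp]: "lin_ext h 0 = 0"
  by (simp add: lin_ext_def)

lemma lin_ext_single: "h m 0 = 0 \<Longrightarrow> lin_ext h (Poly_Mapping.single m c) = h m c"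
  by (simp add: lin_ext_def)

text \<open>Cancellation may shrink the support of \<open>p + q\<close>, so all three sums are taken
  over the union of the supports of \<open>p\<close> and \<open>q\<close>, where the extra terms
  vanish.\<close>

lemma lin_ext_add:
  fixes p q :: "'k \<Rightarrow>\<^sub>0 'c::comm_monoid_add"
  assumes "\<And>m. h m 0 = 0" and "\<And>m a b. h m (a + b) = h m a + h m b"
  shows "lin_ext h (p + q) = lin_ext h p + lin_ext h q"
proof -
  let ?M = "Poly_Mapping.keys p \<union> Poly_Mapping.keys q"
  have *: "lin_ext h u = (\<Sum>m\<in>?M. h m (Poly_Mapping.lookup u m))"
    if "Poly_Mapping.keys u \<subseteq> ?M" for u
    unfolding lin_ext_def using that assms(1)
    by (intro sum.mono_neutral_left) (auto simp: in_keys_iff)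
  show ?thesis
    using * Poly_Mapping.keys_add[of p q]
    by (simp add: lookup_add assms(2) sum.distrib)
qed

definition poly_subst ::
    "('x \<Rightarrow> ('w \<Rightarrow>\<^sub>0 nat) \<Rightarrow>\<^sub>0 complex) \<Rightarrow> (('x::finite \<Rightarrow>\<^sub>0 nat) \<Rightarrow>\<^sub>0 complex) \<Rightarrow> ('w \<Rightarrow>\<^sub>0 nat) \<Rightarrow>\<^sub>0 complex" where
  "poly_subst \<sigma> =
     lin_ext (\<lambda>m c. Poly_Mapping.single 0 c * (\<Prod>x\<in>UNIV. \<sigma> x ^ Poly_Mapping.lookup m x))"

lemma poly_subst_zero [simp]: "poly_subst \<sigma> 0 = 0"
  by (simp add: poly_subst_def)

lemma poly_subst_single:
  "poly_subst \<sigma> (Poly_Mapping.single m c) =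
     Poly_Mapping.single 0 c * (\<Prod>x\<in>UNIV. \<sigma> x ^ Poly_Mapping.lookup m x)"
  unfolding poly_subst_def by (rule lin_ext_single) simp

lemma poly_subst_add: "poly_subst \<sigma> (p + q) = poly_subst \<sigma> p + poly_subst \<sigma> q"
  unfolding poly_subst_def by (rule lin_ext_add) (simp_all add: single_add distrib_right)

lemma poly_subst_uminus: "poly_subst \<sigma> (- p) = - poly_subst \<sigma> p"
  using poly_subst_add[of \<sigma> "- p" p] by (simp add: eq_neg_iff_add_eq_0)

lemma poly_subst_diff: "poly_subst \<sigma> (p - q) = poly_subst \<sigma> p - poly_subst \<sigma> q"
  using poly_subst_add[of \<sigma> p "- q"] by (simp add: poly_subst_uminus)

lemma poly_subst_mult: "poly_subst \<sigma> (p * q) = poly_subst \<sigma> p * poly_subst \<sigma> q"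
proof (induction p rule: poly_mapping_induct)
  case (single m c)
  show ?case
  proof (induction q rule: poly_mapping_induct)
    case (single m' c')
    have "poly_subst \<sigma> (Poly_Mapping.single m c * Poly_Mapping.single m' c') =
        Poly_Mapping.single (0 + 0) (c * c') *
        (\<Prod>x\<in>UNIV. \<sigma> x ^ Poly_Mapping.lookup (m + m') x)"
      by (simp add: mult_single poly_subst_single)
    also have "\<dots> = (Poly_Mapping.single 0 c * Poly_Mapping.single 0 c') *
        ((\<Prod>x\<in>UNIV. \<sigma> x ^ Poly_Mapping.lookup m x) * (\<Prod>x\<in>UNIV. \<sigma> x ^ Poly_Mapping.lookup m' x))"
      by (simp only: mult_single[symmetric] lookup_add power_add prod.distrib)
    finally show ?case
      by (simp only: poly_subst_single mult_ac)
  qed (simp_all add: distrib_left poly_subst_add)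
qed (simp_all add: distrib_right poly_subst_add)

lemma poly_subst_var:
  "poly_subst \<sigma> (Poly_Mapping.single (Poly_Mapping.single x 1) 1) = \<sigma> x"
proof -
  have "(\<Prod>z\<in>UNIV. \<sigma> z ^ Poly_Mapping.lookup (Poly_Mapping.single x 1) z) =
        (\<Prod>z\<in>UNIV. if z = x then \<sigma> z else 1)"
    by (rule prod.cong) (auto simp: lookup_single when_def)
  then show ?thesis
    by (simp add: poly_subst_single single_one)
qed

lemma poly_subst_xvar [simp]: "poly_subst \<sigma> (xvar i) = \<sigma> (Inl i)"
  and poly_subst_yvar [simp]: "poly_subst \<sigma> (yvar i) = \<sigma> (Inr i)"
  by (simp_all only: xvar_def yvar_def poly_subst_var)

lemma poly_subst_minor:
  "poly_subst \<sigma> (minor i j) = \<sigma> (Inl i) * \<sigma> (Inr j) - \<sigma> (Inl j) * \<sigma> (Inr i)"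
  by (simp add: minor_def poly_subst_diff poly_subst_mult)

lemma poly_subst_ideal_span:
  assumes "\<And>g. g \<in> G \<Longrightarrow> poly_subst \<sigma> g \<in> ideal_span K" and "p \<in> ideal_span G"
  shows "poly_subst \<sigma> p \<in> ideal_span K"
  using assms(2)
  by (induction rule: ideal_span_induct)
    (auto simp: poly_subst_add poly_subst_mult assms(1) intro!: ideal_span_add ideal_span_scale ideal_span_zero)

section \<open>The toric parametrization\<close>

text \<open>One form for all ideals involved: J_G has \<open>S\<close> empty and \<open>r\<close>
  adjacency, P_S has \<open>r\<close> connectivity outside \<open>S\<close>, and the completion of
  neighbourhoods passes through further pairs \<open>S\<close>, \<open>r\<close>.\<close>

definition minor_ideal :: "'v set \<Rightarrow> 'v rel \<Rightarrow> 'v xy_poly set" where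
  "minor_ideal S r = ideal_span (xvar ` S \<union> yvar ` S \<union> {minor i j | i j. (i, j) \<in> r})"

lemma xvar_in_minor_ideal: "i \<in> S \<Longrightarrow> xvar i \<in> minor_ideal S r"
  and yvar_in_minor_ideal: "i \<in> S \<Longrightarrow> yvar i \<in> minor_ideal S r"
  and minor_in_minor_ideal: "(i, j) \<in> r \<Longrightarrow> minor i j \<in> minor_ideal S r"
  unfolding minor_ideal_def by (auto intro!: ideal_span_base)

lemma minor_ideal_zero: "0 \<in> minor_ideal S r"
  and minor_ideal_add: "p \<in> minor_ideal S r \<Longrightarrow> q \<in> minor_ideal S r \<Longrightarrow> p + q \<in> minor_ideal S r"
  and minor_ideal_diff: "p \<in> minor_ideal S r \<Longrightarrow> q \<in> minor_ideal S r \<Longrightarrow> p - q \<in> minor_ideal S r"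
  and minor_ideal_mult_left: "p \<in> minor_ideal S r \<Longrightarrow> c * p \<in> minor_ideal S r"
  and minor_ideal_mult_right: "p \<in> minor_ideal S r \<Longrightarrow> p * c \<in> minor_ideal S r"
  unfolding minor_ideal_def
  by (fact ideal_span_zero ideal_span_add ideal_span_diff ideal_span_scale ideal_span_mult_right)+

lemma minor_in_minor_ideal_vertex:
  assumes "i \<in> S \<or> j \<in> S"
  shows "minor i j \<in> minor_ideal S r"
  using assms
  by (metis minor_def minor_ideal_diff minor_ideal_mult_left minor_ideal_mult_right
      xvar_in_minor_ideal yvar_in_minor_ideal)

lemma minor_commute: "minor j i = - minor i j"
  by (simp add: minor_def)

lemma minor_ideal_subset_iff:
  "minor_ideal S r \<subseteq> ideal_span K \<longleftrightarrow>
     (\<forall>i\<in>S. xvar i \<in> ideal_span K \<and> yvar i \<in> ideal_span K) \<and> (\<forall>(i, j)\<in>r. minor i j \<in> ideal_span K)"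
  unfolding minor_ideal_def ideal_span_subset_iff by blast

lemma minor_ideal_subset_minor_ideal_iff:
  "minor_ideal S r \<subseteq> minor_ideal S' r' \<longleftrightarrow>
     (\<forall>i\<in>S. xvar i \<in> minor_ideal S' r' \<and> yvar i \<in> minor_ideal S' r') \<and>
     (\<forall>(i, j)\<in>r. minor i j \<in> minor_ideal S' r')"
  unfolding minor_ideal_def[of S' r'] by (rule minor_ideal_subset_iff)

text \<open>The components of a graph are encoded by a function \<open>rep\<close> that is constant exactly on them. The
  substitution \<open>x\<^sub>i \<mapsto> s\<^sub>i\<close>, \<open>y\<^sub>i \<mapsto> s\<^sub>i t\<^bsub>rep i\<^esub>\<close> (and \<open>x\<^sub>i, y\<^sub>i \<mapsto> 0\<close> for \<open>i \<in> T\<close>) parametrizes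
  the zero set of the ideal; the new indeterminates are \<open>s\<^sub>i = (i, False)\<close> and \<open>t\<^sub>k = (k, True)\<close>.\<close>

definition toric_exponent :: "('v \<Rightarrow> 'v) \<Rightarrow> 'v + 'v \<Rightarrow> ('v \<times> bool) \<Rightarrow>\<^sub>0 nat" where
  "toric_exponent rep z = (case z of
      Inl i \<Rightarrow> Poly_Mapping.single (i, False) 1
    | Inr i \<Rightarrow> Poly_Mapping.single (i, False) 1 + Poly_Mapping.single (rep i, True) 1)"

definition toric_subst ::
    "'v set \<Rightarrow> ('v \<Rightarrow> 'v) \<Rightarrow> 'v + 'v \<Rightarrow> (('v \<times> bool) \<Rightarrow>\<^sub>0 nat) \<Rightarrow>\<^sub>0 complex" where
  "toric_subst T rep z =
     (if z \<in> Inl ` T \<union> Inr ` T then 0 else Poly_Mapping.single (toric_exponent rep z) 1)"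

lemma toric_subst_Inl: "toric_subst T rep (Inl i) =
    (if i \<in> T then 0 else Poly_Mapping.single (toric_exponent rep (Inl i)) 1)"
  and toric_subst_Inr: "toric_subst T rep (Inr i) =
    (if i \<in> T then 0 else Poly_Mapping.single (toric_exponent rep (Inr i)) 1)"
  by (auto simp: toric_subst_def)

text \<open>The exponent vector of the image of the monomial \<open>m\<close> if no variable sent to
  0 divides it; the inner constant sum is a multiple of \<open>toric_exponent rep z\<close>.\<close>

definition toric_degree :: "('v::finite \<Rightarrow> 'v) \<Rightarrow> ('v + 'v \<Rightarrow>\<^sub>0 nat) \<Rightarrow> ('v \<times> bool) \<Rightarrow>\<^sub>0 nat" where
  "toric_degree rep m = (\<Sum>z\<in>UNIV. \<Sum>_<Poly_Mapping.lookup m z. toric_exponent rep z)"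

lemma single_one_power:
  "Poly_Mapping.single k (1::complex) ^ n = Poly_Mapping.single (\<Sum>_<n. k::'a::comm_monoid_add) 1"
  by (induction n) (simp_all add: mult_single add.commute single_one)

lemma prod_single_one:
  "finite A \<Longrightarrow> (\<Prod>z\<in>A. Poly_Mapping.single (h z) (1::complex)) = Poly_Mapping.single (\<Sum>z\<in>A. h z) 1"
  by (induction A rule: finite_induct) (simp_all add: mult_single single_one)

lemma poly_subst_toric_single:
  assumes "\<And>i. i \<in> T \<Longrightarrow> Poly_Mapping.lookup m (Inl i) = 0 \<and> Poly_Mapping.lookup m (Inr i) = 0"
  shows "poly_subst (toric_subst T rep) (Poly_Mapping.single m c) =
           Poly_Mapping.single (toric_degree rep m) c"
proof -
  have "(\<Prod>z\<in>UNIV. toric_subst T rep z ^ Poly_Mapping.lookup m z) =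
        (\<Prod>z\<in>UNIV. Poly_Mapping.single (\<Sum>_<Poly_Mapping.lookup m z. toric_exponent rep z) 1)"
    using assms by (intro prod.cong) (auto simp: toric_subst_def single_one_power single_one)
  then show ?thesis
    by (simp add: poly_subst_single prod_single_one mult_single toric_degree_def)
qed

lemma lookup_sum_const: "Poly_Mapping.lookup (\<Sum>_<n. k) x = n * (Poly_Mapping.lookup k x :: nat)"
  by (induction n) (simp_all add: lookup_add)

lemma lookup_toric_degree:
  "Poly_Mapping.lookup (toric_degree rep m) (i, False) =
     Poly_Mapping.lookup m (Inl i) + Poly_Mapping.lookup m (Inr i)"
  "Poly_Mapping.lookup (toric_degree rep m) (k, True) =
     (\<Sum>i | rep i = k. Poly_Mapping.lookup m (Inr i))"
proof -
  have sum_UNIV: "(\<Sum>z\<in>UNIV. h z) = (\<Sum>i\<in>UNIV. h (Inl i)) + (\<Sum>i\<in>UNIV. h (Inr i))"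
    for h :: "'a + 'a \<Rightarrow> nat"
    using sum.Plus[of "UNIV :: 'a set" "UNIV :: 'a set" h] by simp
  show "Poly_Mapping.lookup (toric_degree rep m) (i, False) =
     Poly_Mapping.lookup m (Inl i) + Poly_Mapping.lookup m (Inr i)"
    by (simp add: toric_degree_def lookup_sum lookup_sum_const sum_UNIV toric_exponent_def
        lookup_add lookup_single when_def distrib_left sum.distrib
        if_distrib[where f = "times c" for c] cong: if_cong)
  show "Poly_Mapping.lookup (toric_degree rep m) (k, True) =
     (\<Sum>i | rep i = k. Poly_Mapping.lookup m (Inr i))"
    by (simp add: toric_degree_def lookup_sum lookup_sum_const sum_UNIV toric_exponent_def
        lookup_add lookup_single when_def if_distrib[where f = "times c" for c] sum.If_cases
        cong: if_cong)
qed

text \<open>Two monomials of equal toric degree are joined by moves replacing a factor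
  \<open>y\<^sub>i x\<^sub>j\<close> by \<open>x\<^sub>i y\<^sub>j\<close>, each of which changes the monomial by a multiple of a minor.\<close>

lemma monomial_diff_in_minor_ideal:
  fixes rep :: "'v::finite \<Rightarrow> 'v"
  assumes "\<And>i. i \<in> T \<Longrightarrow> Poly_Mapping.lookup m (Inr i) = 0 \<and> Poly_Mapping.lookup m' (Inr i) = 0"
    and "toric_degree rep m = toric_degree rep m'"
  shows "Poly_Mapping.single m c - Poly_Mapping.single m' c \<in>
           minor_ideal T {(i, j). i \<notin> T \<and> j \<notin> T \<and> rep i = rep j}" (is "_ \<in> ?I")
  using assms
\<comment> \<open>The measure is the total excess of the y-exponents of \<open>m\<close> over those
  of \<open>m'\<close>; truncated subtraction ignores the deficits.\<close>
proof (induction "\<Sum>i\<in>UNIV. Poly_Mapping.lookup m (Inr i) - Poly_Mapping.lookup m' (Inr i)"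
    arbitrary: m rule: less_induct)
  case less
  let ?b = "\<lambda>m i. Poly_Mapping.lookup m (Inr i)" and ?a = "\<lambda>m i. Poly_Mapping.lookup m (Inl i)"
  have deg: "?a m i + ?b m i = ?a m' i + ?b m' i" for i
    using less.prems(2) lookup_toric_degree(1)[of rep _ i] by metis
  have group: "(\<Sum>i | rep i = k. ?b m i) = (\<Sum>i | rep i = k. ?b m' i)" for k
    using less.prems(2) lookup_toric_degree(2)[of rep _ k] by metis
  show ?case
  proof (cases "\<forall>i. ?b m i \<le> ?b m' i")
    case True
    \<comment> \<open>The y-exponents have equal sums over each class, so one strict inequality
      among weak ones is impossible. The x-exponents then agree by \<open>deg\<close>.\<close>
    have "?b m i = ?b m' i" for i
    proof (rule ccontr)
      assume "?b m i \<noteq> ?b m' i"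
      then have "(\<Sum>l | rep l = rep i. ?b m l) < (\<Sum>l | rep l = rep i. ?b m' l)"
        using True by (intro sum_strict_mono_ex1) (auto intro!: exI[of _ i] le_neq_implies_less)
      then show False
        using group by simp
    qed
    then have "Poly_Mapping.lookup m z = Poly_Mapping.lookup m' z" for z
      using deg by (cases z) (metis add_right_cancel)+
    then have "m = m'"
      by (intro poly_mapping_eqI)
    then show ?thesis
      by (simp add: minor_ideal_zero)
  next
    case False
    then obtain i where i: "?b m' i < ?b m i"
      by (auto simp: not_le)
    \<comment> \<open>An excess at \<open>i\<close> must be balanced by a deficit at some
      \<open>j\<close> of the same class.\<close>
    obtain j where j: "rep j = rep i" "?b m j < ?b m' j"
    proof (rule ccontr)
      assume "\<not> thesis"
      with that have "?b m' l \<le> ?b m l" if "rep l = rep i" for l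
        using that by (meson not_le)
      then have "(\<Sum>l | rep l = rep i. ?b m' l) < (\<Sum>l | rep l = rep i. ?b m l)"
        using i by (intro sum_strict_mono_ex1) auto
      then show False
        using group by simp
    qed
    have ij: "i \<noteq> j" "i \<notin> T" "j \<notin> T"
      using i j less.prems(1) by fastforce+
    have aj: "0 < ?a m j"
      using deg[of j] j by linarith
    \<comment> \<open>\<open>n\<close> is the common part: \<open>m\<close> is \<open>n\<close>
      times x_j y_i and \<open>m1\<close> is \<open>n\<close> times x_i y_j. Both removed exponents
      are positive, so nothing is truncated.\<close>
    define n where "n = m - Poly_Mapping.single (Inr i) 1 - Poly_Mapping.single (Inl j) 1"
    define m1 where "m1 = n + (Poly_Mapping.single (Inl i) 1 + Poly_Mapping.single (Inr j) 1)"
    have m: "m = n + (Poly_Mapping.single (Inl j) 1 + Poly_Mapping.single (Inr i) 1)"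
      using i aj by (intro poly_mapping_eqI)
        (auto simp: n_def lookup_add lookup_minus lookup_single when_def)
    have b1: "?b m1 l = (if l = i then ?b m i - 1 else if l = j then ?b m j + 1 else ?b m l)" for l
      using ij i by (auto simp: m1_def n_def lookup_add lookup_minus lookup_single when_def)
    have "toric_exponent rep (Inl i) + toric_exponent rep (Inr j) =
          toric_exponent rep (Inl j) + toric_exponent rep (Inr i)"
      using j by (simp add: toric_exponent_def add_ac)
    moreover have "toric_degree rep (u + v) = toric_degree rep u + toric_degree rep v" for u v
      by (intro poly_mapping_eqI)
        (simp add: toric_degree_def lookup_add lookup_sum lookup_sum_const distrib_right sum.distrib)
    moreover have "toric_degree rep (Poly_Mapping.single z 1) = toric_exponent rep z" for z
      by (intro poly_mapping_eqI)
        (simp add: toric_degree_def lookup_sum lookup_sum_const lookup_single when_def if_distrib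
          if_distribR cong: if_cong)
    ultimately have "toric_degree rep m1 = toric_degree rep m"
      by (simp add: m1_def m)
    moreover have "(\<Sum>l\<in>UNIV. ?b m1 l - ?b m' l) < (\<Sum>l\<in>UNIV. ?b m l - ?b m' l)"
    proof (rule sum_strict_mono_ex1)
      show "\<forall>l\<in>UNIV. ?b m1 l - ?b m' l \<le> ?b m l - ?b m' l"
        using j by (simp add: b1 diff_le_mono2)
      show "\<exists>l\<in>UNIV. ?b m1 l - ?b m' l < ?b m l - ?b m' l"
        using i by (intro bexI[of _ i]) (simp_all add: b1)
    qed simp
    ultimately have "Poly_Mapping.single m1 c - Poly_Mapping.single m' c \<in> ?I"
      using less.prems ij by (intro less.hyps) (auto simp: b1)
    moreover have "Poly_Mapping.single m c - Poly_Mapping.single m1 c =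
        Poly_Mapping.single n c * minor j i"
      by (simp add: m m1_def minor_def xvar_def yvar_def right_diff_distrib mult_single)
    moreover have "Poly_Mapping.single n c * minor j i \<in> ?I"
      using ij j by (intro minor_ideal_mult_left minor_in_minor_ideal) auto
    ultimately have "(Poly_Mapping.single m c - Poly_Mapping.single m1 c) +
        (Poly_Mapping.single m1 c - Poly_Mapping.single m' c) \<in> ?I"
      by (intro minor_ideal_add) simp_all
    then show ?thesis
      by simp
  qed
qed

lemma single_eq_var_mult:
  assumes "Poly_Mapping.lookup m z \<noteq> (0::nat)"
  shows "Poly_Mapping.single m (c::complex) =
    Poly_Mapping.single (Poly_Mapping.single z 1) 1 * Poly_Mapping.single (m - Poly_Mapping.single z 1) c"
proof -
  have "m = Poly_Mapping.single z 1 + (m - Poly_Mapping.single z 1)"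
    using assms by (intro poly_mapping_eqI) (auto simp: lookup_add lookup_minus lookup_single when_def)
  then show ?thesis
    by (metis mult_single mult_1)
qed

text \<open>The additive map \<open>\<psi>\<close> that lifts each toric monomial to a chosen preimage inverts the
  substitution modulo the ideal.\<close>

lemma minor_ideal_eq_toric_kernel:
  fixes rep :: "'v::finite \<Rightarrow> 'v"
  shows "minor_ideal T {(i, j). i \<notin> T \<and> j \<notin> T \<and> rep i = rep j} =
           {p. poly_subst (toric_subst T rep) p = 0}" (is "?I = ?K")
proof
  let ?\<phi> = "poly_subst (toric_subst T rep)"
  \<comment> \<open>The zero ideal is written as a span so that \<open>poly_subst_ideal_span\<close>
    applies.\<close>
  have "?\<phi> g \<in> ideal_span {}"
    if "g \<in> xvar ` T \<union> yvar ` T \<union> {minor i j | i j. i \<notin> T \<and> j \<notin> T \<and> rep i = rep j}" for g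
  proof -
    have "?\<phi> g = 0"
      using that by (auto simp: poly_subst_minor)
        (auto simp: toric_subst_def toric_exponent_def mult_single add_ac)
    then show ?thesis by (simp add: ideal_span_zero)
  qed
  note gens = this
  show "?I \<subseteq> ?K"
  proof
    fix p assume "p \<in> ?I"
    then have "?\<phi> p \<in> ideal_span {}"
      unfolding minor_ideal_def by (rule poly_subst_ideal_span[rotated]) (rule gens, simp)
    then show "p \<in> ?K"
      by (simp add: module.span_empty[OF module_mult])
  qed
  define good where "good m \<longleftrightarrow>
    (\<forall>i\<in>T. Poly_Mapping.lookup m (Inl i) = 0 \<and> Poly_Mapping.lookup m (Inr i) = 0)" for m :: "'v + 'v \<Rightarrow>\<^sub>0 nat"
  define \<rho> where "\<rho> k = (SOME m. good m \<and> toric_degree rep m = k)" for k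
  define \<psi> where "\<psi> = lin_ext (\<lambda>k c. Poly_Mapping.single (\<rho> k) (c::complex))"
  have \<psi>_add: "\<psi> (p + q) = \<psi> p + \<psi> q" for p q
    unfolding \<psi>_def by (rule lin_ext_add) (simp_all add: single_add)
  have \<psi>_single: "\<psi> (Poly_Mapping.single k c) = Poly_Mapping.single (\<rho> k) c" for k c
    unfolding \<psi>_def by (rule lin_ext_single) simp
  have \<psi>_0: "\<psi> 0 = 0"
    by (simp add: \<psi>_def)
  have "p - \<psi> (?\<phi> p) \<in> ?I" for p
  proof (induction p rule: poly_mapping_induct)
    case zero
    then show ?case by (simp add: \<psi>_0 minor_ideal_zero)
  next
    case (single m c)
    show ?case
    proof (cases "good m")
      case True
      have "good (\<rho> (toric_degree rep m)) \<and> toric_degree rep (\<rho> (toric_degree rep m)) = toric_degree rep m"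
        unfolding \<rho>_def 
        by (rule someI[of "\<lambda>m'. good m' \<and> toric_degree rep m' = toric_degree rep m" m]) (simp add: True)
      moreover have "?\<phi> (Poly_Mapping.single m c) = Poly_Mapping.single (toric_degree rep m) c"
        using True by (intro poly_subst_toric_single) (auto simp: good_def)
      ultimately show ?thesis
        using True monomial_diff_in_minor_ideal[of T m "\<rho> (toric_degree rep m)" rep c]
        by (auto simp: \<psi>_single good_def)
    next
      case False
      \<comment> \<open>A monomial divisible by a variable of \<open>T\<close> lies in the ideal and
        has image 0, so nothing needs lifting.\<close>
      then obtain z where z: "z \<in> Inl ` T \<union> Inr ` T" "Poly_Mapping.lookup m z \<noteq> 0"
        by (auto simp: good_def)
      have "(\<Prod>z\<in>UNIV. toric_subst T rep z ^ Poly_Mapping.lookup m z) = 0"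
        using z by (intro prod_zero bexI[of _ z]) (auto simp: toric_subst_def zero_power)
      then have "?\<phi> (Poly_Mapping.single m c) = 0"
        by (simp add: poly_subst_single)
      moreover note single_eq_var_mult[OF z(2), of c]
      moreover have "Poly_Mapping.single (Poly_Mapping.single z 1) 1 \<in> ?I"
        using z(1) by (auto simp: xvar_def[symmetric] yvar_def[symmetric] xvar_in_minor_ideal
            yvar_in_minor_ideal simp del: One_nat_def)
      ultimately show ?thesis
        by (simp add: \<psi>_0 minor_ideal_mult_right)
    qed
  next
    case (add p q)
    have "(p + q) - \<psi> (?\<phi> (p + q)) = (p - \<psi> (?\<phi> p)) + (q - \<psi> (?\<phi> q))"
      by (simp add: poly_subst_add \<psi>_add)
    with add show ?case
      by (simp only: minor_ideal_add)
  qed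
  \<comment> \<open>For \<open>p\<close> in the kernel the difference just treated is
    \<open>p\<close> itself.\<close>
  then show "?K \<subseteq> ?I"
    by (metis (mono_tags, lifting) \<psi>_0 diff_zero mem_Collect_eq subsetI)
qed

section \<open>Connectivity outside a vertex set and the prime ideals it defines\<close>

definition restricted_conn :: "'v rel \<Rightarrow> 'v set \<Rightarrow> 'v rel" where
  "restricted_conn r T = {(i, j). i \<notin> T \<and> j \<notin> T \<and> (i, j) \<in> (Restr r (- T))\<^sup>*}"

lemma restricted_conn_refl: "i \<notin> T \<Longrightarrow> (i, i) \<in> restricted_conn r T"
  by (simp add: restricted_conn_def)

lemma restricted_conn_edge: "(i, j) \<in> r \<Longrightarrow> i \<notin> T \<Longrightarrow> j \<notin> T \<Longrightarrow> (i, j) \<in> restricted_conn r T"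
  by (auto simp: restricted_conn_def)

lemma restricted_conn_trans:
  "(i, j) \<in> restricted_conn r T \<Longrightarrow> (j, k) \<in> restricted_conn r T \<Longrightarrow> (i, k) \<in> restricted_conn r T"
  by (auto simp: restricted_conn_def)

lemma restricted_conn_sym:
  assumes "sym r" and "(i, j) \<in> restricted_conn r T"
  shows "(j, i) \<in> restricted_conn r T"
proof -
  have "sym ((Restr r (- T))\<^sup>*)"
    using assms(1) by (intro sym_rtrancl) (auto simp: sym_def)
  with assms(2) show ?thesis
    by (auto simp: restricted_conn_def dest: symD)
qed

text \<open>Requiring both ends outside \<open>T\<close> discards the reflexive pairs that the
  closure adds on \<open>T\<close>, so the classes are exactly the components of the remaining
  graph.\<close>

lemma equiv_restricted_conn:
  assumes "sym r"
  shows "equiv (- T) (restricted_conn r T)"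
proof (rule equivI)
  show "restricted_conn r T \<subseteq> (- T) \<times> (- T)"
    by (auto simp: restricted_conn_def)
  show "refl_on (- T) (restricted_conn r T)"
    by (simp add: refl_on_def restricted_conn_refl)
  show "sym (restricted_conn r T)"
    using restricted_conn_sym[OF assms] by (blast intro: symI)
  show "trans (restricted_conn r T)"
    by (rule transI) (rule restricted_conn_trans)
qed

lemma restricted_conn_mono:
  assumes "r \<subseteq> r'" and "T' \<subseteq> T"
  shows "restricted_conn r T \<subseteq> restricted_conn r' T'"
proof -
  have "Restr r (- T) \<subseteq> Restr r' (- T')"
    using assms by blast
  from rtrancl_mono[OF this] show ?thesis
    using assms by (auto simp: restricted_conn_def)
qed

abbreviation conn_ideal :: "'v::{finite,linorder} rel \<Rightarrow> 'v set \<Rightarrow> 'v xy_poly set" where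
  "conn_ideal r T \<equiv> minor_ideal T (restricted_conn r T)"

lemma conn_ideal_eq_toric_kernel:
  fixes r :: "'v::{finite,linorder} rel"
  assumes "sym r"
  obtains rep where "conn_ideal r T = {p. poly_subst (toric_subst T rep) p = 0}"
    and "\<And>i j. i \<notin> T \<Longrightarrow> j \<notin> T \<Longrightarrow> rep i = rep j \<longleftrightarrow> (i, j) \<in> restricted_conn r T"
proof
  let ?R = "restricted_conn r T"
  \<comment> \<open>The least vertex of the component. For \<open>i\<close> in \<open>T\<close> the
    class is empty and the value unspecified, which is harmless because the variables of
    \<open>i\<close> go to 0.\<close>
  let ?rep = "\<lambda>i. Min (?R `` {i})"
  have eq: "equiv (- T) ?R"
    by (rule equiv_restricted_conn[OF assms])
  have rep: "(i, ?rep i) \<in> ?R" if "i \<notin> T" for i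
    using Min_in[of "?R `` {i}"] restricted_conn_refl[OF that, of r] by fastforce
  show *: "?rep i = ?rep j \<longleftrightarrow> (i, j) \<in> ?R" if "i \<notin> T" "j \<notin> T" for i j
  proof
    assume "?rep i = ?rep j"
    then show "(i, j) \<in> ?R"
      using rep[OF that(1)] rep[OF that(2)]
      by (metis assms restricted_conn_sym restricted_conn_trans)
  next
    assume "(i, j) \<in> ?R"
    then show "?rep i = ?rep j"
      using equiv_class_eq[OF eq] by metis
  qed
  have "?R = {(i, j). i \<notin> T \<and> j \<notin> T \<and> ?rep i = ?rep j}"
    using * by (auto simp: restricted_conn_def)
  then show "conn_ideal r T = {p. poly_subst (toric_subst T ?rep) p = 0}"
    using minor_ideal_eq_toric_kernel[of T ?rep] by simp
qed

text \<open>The ideal is the kernel of a multiplicative map into a polynomial ring without zero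
  divisors.\<close>

lemma conn_ideal_prime:
  assumes "sym r" and "p * q \<in> conn_ideal r T"
  shows "p \<in> conn_ideal r T \<or> q \<in> conn_ideal r T"
proof -
  obtain rep where "conn_ideal r T = {p. poly_subst (toric_subst T rep) p = 0}"
    using conn_ideal_eq_toric_kernel[OF assms(1)] by metis
  with assms(2) show ?thesis
    by (simp add: poly_subst_mult)
qed

lemma conn_ideal_power:
  assumes "sym r" and "p ^ k \<in> conn_ideal r T" and "0 < k"
  shows "p \<in> conn_ideal r T"
  using assms(2,3)
proof (induction k)
  case (Suc k)
  then show ?case
    using conn_ideal_prime[OF assms(1), of p "p ^ k" T] by (cases k) auto
qed simp

lemma single_neq_0: "c \<noteq> 0 \<Longrightarrow> Poly_Mapping.single m c \<noteq> 0"
  by (metis lookup_single_eq lookup_zero)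

lemma xvar_in_conn_ideal_iff:
  assumes "sym r"
  shows "xvar i \<in> conn_ideal r T \<longleftrightarrow> i \<in> T"
proof -
  obtain rep where "conn_ideal r T = {p. poly_subst (toric_subst T rep) p = 0}"
    using conn_ideal_eq_toric_kernel[OF assms] by metis
  then show ?thesis
    by (auto simp: toric_subst_def single_neq_0)
qed

text \<open>For \<open>i\<close> and \<open>j\<close> outside \<open>T\<close> the minor is mapped
  to s_i s_j (t_{rep j} - t_{rep i}), which vanishes exactly when the representatives agree.\<close>

lemma minor_in_conn_ideal_iff:
  assumes "sym r"
  shows "minor i j \<in> conn_ideal r T \<longleftrightarrow> i \<in> T \<or> j \<in> T \<or> (i, j) \<in> restricted_conn r T"
proof
  assume *: "minor i j \<in> conn_ideal r T"
  obtain rep where rep: "conn_ideal r T = {p. poly_subst (toric_subst T rep) p = 0}"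
    "\<And>i j. i \<notin> T \<Longrightarrow> j \<notin> T \<Longrightarrow> rep i = rep j \<longleftrightarrow> (i, j) \<in> restricted_conn r T"
    using conn_ideal_eq_toric_kernel[OF assms] by metis
  show "i \<in> T \<or> j \<in> T \<or> (i, j) \<in> restricted_conn r T"
  proof (rule ccontr)
    assume neg: "\<not> ?thesis"
    then have "rep i \<noteq> rep j"
      using rep(2) by blast
    let ?m = "toric_exponent rep (Inl i) + toric_exponent rep (Inr j)"
      and ?m' = "toric_exponent rep (Inl j) + toric_exponent rep (Inr i)"
    have "Poly_Mapping.single ?m (1::complex) = Poly_Mapping.single ?m' 1"
      using * neg by (auto simp: rep(1) poly_subst_minor toric_subst_Inl toric_subst_Inr mult_single)
    then have "?m = ?m'"
      by (metis lookup_single_eq lookup_single_not_eq one_neq_zero)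
    \<comment> \<open>The exponent of t_{rep j} is 1 on the left and 0 on the right.\<close>
    then have "Poly_Mapping.lookup ?m (rep j, True) = Poly_Mapping.lookup ?m' (rep j, True)"
      by simp
    with \<open>rep i \<noteq> rep j\<close> show False
      by (simp add: toric_exponent_def lookup_add lookup_single when_def)
  qed
next
  assume "i \<in> T \<or> j \<in> T \<or> (i, j) \<in> restricted_conn r T"
  then show "minor i j \<in> conn_ideal r T"
    using minor_in_minor_ideal minor_in_minor_ideal_vertex by metis
qed

section \<open>Completing the neighbourhood of a vertex\<close>

definition kill_vertex :: "'v \<Rightarrow> 'v + 'v \<Rightarrow> 'v xy_poly" where
  "kill_vertex v z =
     (if z = Inl v \<or> z = Inr v then 0 else Poly_Mapping.single (Poly_Mapping.single z 1) 1)"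

lemma kill_vertex_Inl: "kill_vertex v (Inl i) = (if i = v then 0 else xvar i)"
  and kill_vertex_Inr: "kill_vertex v (Inr i) = (if i = v then 0 else yvar i)"
  by (simp_all add: kill_vertex_def xvar_def yvar_def)

lemma monomial_eq_prod_vars:
  fixes m :: "'x::finite \<Rightarrow>\<^sub>0 nat"
  shows "Poly_Mapping.single m (c::complex) = Poly_Mapping.single 0 c *
    (\<Prod>z\<in>UNIV. Poly_Mapping.single (Poly_Mapping.single z 1) 1 ^ Poly_Mapping.lookup m z)"
proof -
  have "(\<Sum>z\<in>UNIV. \<Sum>_<Poly_Mapping.lookup m z. Poly_Mapping.single z 1) = m"
    by (intro poly_mapping_eqI)
      (simp add: lookup_sum lookup_sum_const lookup_single when_def
        if_distrib[where f = "times c" for c] cong: if_cong)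
  then show ?thesis
    by (simp add: single_one_power prod_single_one mult_single del: sum_constant)
qed

lemma poly_subst_kill_vertex_single:
  "poly_subst (kill_vertex v) (Poly_Mapping.single m c) =
     (if Poly_Mapping.lookup m (Inl v) = 0 \<and> Poly_Mapping.lookup m (Inr v) = 0
      then Poly_Mapping.single m c else 0)"
proof (cases "Poly_Mapping.lookup m (Inl v) = 0 \<and> Poly_Mapping.lookup m (Inr v) = 0")
  case True
  then have "(\<Prod>z\<in>UNIV. kill_vertex v z ^ Poly_Mapping.lookup m z) =
      (\<Prod>z\<in>UNIV. Poly_Mapping.single (Poly_Mapping.single z 1) 1 ^ Poly_Mapping.lookup m z)"
    by (intro prod.cong) (auto simp: kill_vertex_def)
  then have "poly_subst (kill_vertex v) (Poly_Mapping.single m c) = Poly_Mapping.single m c"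
    by (simp only: poly_subst_single monomial_eq_prod_vars[of m c, symmetric])
  with True show ?thesis
    by simp
next
  case False
  then have "(\<Prod>z\<in>UNIV. kill_vertex v z ^ Poly_Mapping.lookup m z) = 0"
    by (intro prod_zero) (auto simp: kill_vertex_def zero_power)
  with False show ?thesis
    by (auto simp: poly_subst_single)
qed

lemma poly_subst_kill_vertex_idem:
  "poly_subst (kill_vertex v) (poly_subst (kill_vertex v) p) = poly_subst (kill_vertex v) p"
  by (induction p rule: poly_mapping_induct) (simp_all add: poly_subst_kill_vertex_single poly_subst_add)

lemma diff_kill_vertex_in_ideal:
  "p - poly_subst (kill_vertex v) p \<in> ideal_span {xvar v, yvar v}"
proof (induction p rule: poly_mapping_induct)
  case zero
  then show ?case by (simp add: ideal_span_zero)
next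
  case (single m c)
  have "Poly_Mapping.single m c \<in> ideal_span {xvar v, yvar v}"
    if "Poly_Mapping.lookup m (Inl v) \<noteq> 0 \<or> Poly_Mapping.lookup m (Inr v) \<noteq> 0"
    using that
  proof
    assume "Poly_Mapping.lookup m (Inl v) \<noteq> 0"
    from single_eq_var_mult[OF this, of c] show ?thesis
      unfolding xvar_def[symmetric]
      by (metis ideal_span_base ideal_span_mult_right insertI1 insertI2)
  next
    assume "Poly_Mapping.lookup m (Inr v) \<noteq> 0"
    from single_eq_var_mult[OF this, of c] show ?thesis
      unfolding yvar_def[symmetric]
      by (metis ideal_span_base ideal_span_mult_right insertI1 insertI2)
  qed
  then show ?case
    by (auto simp: poly_subst_kill_vertex_single ideal_span_zero)
next
  case (add p q)
  then have "(p - poly_subst (kill_vertex v) p) + (q - poly_subst (kill_vertex v) q)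
      \<in> ideal_span {xvar v, yvar v}"
    by (rule ideal_span_add)
  then show ?case
    by (simp add: poly_subst_add algebra_simps)
qed

text \<open>The identity x_v f_ij = x_i f_vj - x_j f_vi, and the same with y_v, y_i, y_j as
  coefficients, settles the two generators.\<close>

lemma mult_minor_in_minor_ideal:
  assumes "(v, i) \<in> r" and "(v, j) \<in> r" and "p \<in> ideal_span {xvar v, yvar v}"
  shows "p * minor i j \<in> minor_ideal S r"
  using assms(3)
proof (induction rule: ideal_span_induct)
  case base
  then show ?case by (simp add: minor_ideal_zero)
next
  case (step c x q)
  have "a * minor v j - b * minor v i \<in> minor_ideal S r" for a b
    using minor_in_minor_ideal[OF assms(1), of S] minor_in_minor_ideal[OF assms(2), of S]
    by (intro minor_ideal_diff minor_ideal_mult_left)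
  moreover have "xvar v * minor i j = xvar i * minor v j - xvar j * minor v i"
    and "yvar v * minor i j = yvar i * minor v j - yvar j * minor v i"
    by (simp_all add: minor_def algebra_simps)
  ultimately have "x * minor i j \<in> minor_ideal S r"
    using step(1) by (metis insertE singletonD)
  then have "c * (x * minor i j) + q * minor i j \<in> minor_ideal S r"
    using step(2) minor_ideal_mult_left minor_ideal_add by blast
  then show ?case
    by (simp add: algebra_simps)
qed

text \<open>Modulo \<open>minor_ideal S r\<close> the coefficients of the new minors may be taken free of
  \<open>x\<^sub>v, y\<^sub>v\<close>, as \<open>x\<^sub>v\<close> and \<open>y\<^sub>v\<close> multiply these minors into \<open>minor_ideal S r\<close>; such an element survives
  the substitution \<open>x\<^sub>v = y\<^sub>v = 0\<close>, which maps \<open>minor_ideal (insert v S) r\<close> into \<open>minor_ideal S r\<close>.\<close>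

lemma minor_ideal_completion_inter:
  fixes r :: "'v::finite rel"
  assumes N: "\<And>i j. (i, j) \<in> N \<Longrightarrow> (v, i) \<in> r \<and> (v, j) \<in> r \<and> i \<noteq> v \<and> j \<noteq> v"
    and p: "p \<in> minor_ideal S (r \<union> N)" "p \<in> minor_ideal (insert v S) r"
  shows "p \<in> minor_ideal S r"
proof -
  let ?\<pi> = "poly_subst (kill_vertex v)"
  have "\<exists>a \<in> minor_ideal S r. ?\<pi> (p - a) = p - a"
    using p(1) unfolding minor_ideal_def[of S "r \<union> N"]
  proof (induction rule: ideal_span_induct)
    case base
    show ?case by (rule bexI[of _ 0]) (simp_all add: minor_ideal_zero)
  next
    case (step c x q)
    then obtain a where a: "a \<in> minor_ideal S r" "?\<pi> (q - a) = q - a"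
      by blast
    consider "x \<in> minor_ideal S r" | i j where "(i, j) \<in> N" "x = minor i j"
      using step(1) by (auto intro: xvar_in_minor_ideal yvar_in_minor_ideal minor_in_minor_ideal)
    then show ?case
    proof cases
      case 1
      then have "c * x + a \<in> minor_ideal S r"
        using a(1) by (intro minor_ideal_add minor_ideal_mult_left)
      then show ?thesis
        using a(2) by (intro bexI[of _ "c * x + a"]) simp_all
    next
      case 2
      \<comment> \<open>The coefficient splits into \<open>c - ?\<pi> c\<close>, which is in (x_v,
        y_v) and is absorbed into \<open>a\<close>, and \<open>?\<pi> c\<close>, which the
        substitution fixes along with the minor \<open>x\<close>.\<close>
      have "(c - ?\<pi> c) * x \<in> minor_ideal S r"
        using mult_minor_in_minor_ideal[OF _ _ diff_kill_vertex_in_ideal[of c v]] N 2 by blast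
      then have "(c - ?\<pi> c) * x + a \<in> minor_ideal S r"
        using a(1) by (intro minor_ideal_add)
      moreover have "?\<pi> x = x"
        using N[OF 2(1)] by (simp add: 2(2) poly_subst_minor kill_vertex_Inl kill_vertex_Inr)
          (simp add: minor_def)
      moreover have eq: "c * x + q - ((c - ?\<pi> c) * x + a) = ?\<pi> c * x + (q - a)"
        by (simp add: algebra_simps)
      ultimately have "?\<pi> (c * x + q - ((c - ?\<pi> c) * x + a)) = c * x + q - ((c - ?\<pi> c) * x + a)"
        by (simp only: eq poly_subst_add poly_subst_mult poly_subst_kill_vertex_idem a(2))
      with \<open>(c - ?\<pi> c) * x + a \<in> minor_ideal S r\<close> show ?thesis ..
    qed
  qed
  then obtain a where a: "a \<in> minor_ideal S r" "?\<pi> (p - a) = p - a"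
    by blast
  have "minor_ideal S r \<subseteq> minor_ideal (insert v S) r"
    unfolding minor_ideal_def by (rule ideal_span_mono) blast
  with a(1) p(2) have "p - a \<in> minor_ideal (insert v S) r"
    by (intro minor_ideal_diff) auto
  \<comment> \<open>The substitution sends the variables of \<open>v\<close> and the minors at
    \<open>v\<close> to 0 and fixes all other generators, which already belong to the smaller
    ideal.\<close>
  moreover have "?\<pi> g \<in> minor_ideal S r"
    if "g \<in> xvar ` insert v S \<union> yvar ` insert v S \<union> {minor i j | i j. (i, j) \<in> r}" for g
  proof -
    have "?\<pi> g = 0 \<or> ?\<pi> g = g \<and> g \<in> minor_ideal S r"
      using that
      by (auto simp: poly_subst_minor kill_vertex_Inl kill_vertex_Inr xvar_in_minor_ideal
          yvar_in_minor_ideal minor_in_minor_ideal)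
        (simp_all add: minor_def)
    then show ?thesis
      by (auto simp: minor_ideal_zero)
  qed
  ultimately have "?\<pi> (p - a) \<in> minor_ideal S r"
    unfolding minor_ideal_def by (rule poly_subst_ideal_span[rotated]) simp
  with a have "(p - a) + a \<in> minor_ideal S r"
    by (metis minor_ideal_add)
  then show ?thesis by simp
qed

text \<open>While some neighbourhood outside \<open>S\<close> is incomplete, the ideal is recovered
  from the one with larger \<open>r\<close> and the one with larger \<open>S\<close>; both lower the
  measure. When all are complete, the ideal is P_S itself.\<close>

lemma in_minor_ideal_if_in_all_conn_ideals:
  fixes r :: "'v::{finite,linorder} rel"
  assumes "sym r" and "\<And>T. S \<subseteq> T \<Longrightarrow> p \<in> conn_ideal r T"
  shows "p \<in> minor_ideal S r"
  using assms
proof (induction "card (- S) + card (- r)" arbitrary: S r rule: less_induct)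
  case less
  define N where "N v = {(i, j). (v, i) \<in> r \<and> (v, j) \<in> r \<and> i \<noteq> v \<and> j \<noteq> v}" for v
  show ?case
  \<comment> \<open>\<open>N v\<close> also contains diagonal pairs, whose minors vanish;
    \<open>i \<noteq> j\<close> asks for an edge that is really missing.\<close>
  proof (cases "\<exists>v i j. v \<notin> S \<and> i \<notin> S \<and> j \<notin> S \<and> i \<noteq> j \<and> (i, j) \<in> N v - r")
    case True
    then obtain v i j where v: "v \<notin> S" "(i, j) \<in> N v - r"
      by blast
    have less: "card (- S) + card (- (r \<union> N v)) < card (- S) + card (- r)"
      using v(2) by (intro add_strict_left_mono psubset_card_mono) auto
    have sym: "sym (r \<union> N v)"
      using less.prems(1) by (auto simp: sym_def N_def)
    have "p \<in> conn_ideal (r \<union> N v) T" if "S \<subseteq> T" for T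
    proof -
      have "conn_ideal r T \<subseteq> conn_ideal (r \<union> N v) T"
        using restricted_conn_mono[of r "r \<union> N v" T T] unfolding minor_ideal_def
        by (intro ideal_span_mono) auto
      with less.prems(2)[OF that] show ?thesis by blast
    qed
    then have "p \<in> minor_ideal S (r \<union> N v)"
      by (rule less.hyps[OF less sym])
    moreover have "card (- insert v S) + card (- r) < card (- S) + card (- r)"
      using v(1) by (intro add_strict_right_mono psubset_card_mono) auto
    from less.hyps[OF this less.prems(1)] less.prems(2) have "p \<in> minor_ideal (insert v S) r"
      by blast
    ultimately show ?thesis
      by (rule minor_ideal_completion_inter[rotated]) (simp add: N_def)
  next
    case False
    \<comment> \<open>Walks shorten to single edges: the start and the next vertex are both
      neighbours of the current one, hence adjacent or equal.\<close>
    have *: "i = j \<or> (i, j) \<in> r" if "(i, j) \<in> restricted_conn r S" for i j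
    proof -
      have "(i, j) \<in> (Restr r (- S))\<^sup>*" and "i \<notin> S"
        using that by (auto simp: restricted_conn_def)
      then show ?thesis
      proof (induction rule: rtrancl_induct)
        case (step k l)
        then have "i = k \<or> (k, i) \<in> r"
          using less.prems(1) by (auto dest: symD)
        with step False show ?case
          unfolding N_def by fast
      qed simp
    qed
    have "conn_ideal r S \<subseteq> minor_ideal S r"
      using * by (auto simp: minor_ideal_subset_minor_ideal_iff xvar_in_minor_ideal yvar_in_minor_ideal)
        (metis minor_in_minor_ideal minor_def diff_self minor_ideal_zero)
    then show ?thesis
      using less.prems(2)[of S] by blast
  qed
qed

section \<open>Minimal cuts\<close>

text \<open>If all neighbours of \<open>i\<close> outside \<open>S\<close> lay in one component,
  every passage of a walk through \<open>i\<close> could be bypassed, and returning \<open>i\<close>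
  would join nothing new.\<close>

lemma restricted_conn_cut_neighbours:
  assumes "sym r" and "a \<notin> S" "b \<notin> S"
    and "(a, b) \<in> restricted_conn r (S - {i})" and "(a, b) \<notin> restricted_conn r S"
  shows "\<exists>c d. c \<notin> S \<and> d \<notin> S \<and> (i, c) \<in> r \<and> (i, d) \<in> r \<and> (c, d) \<notin> restricted_conn r S"
proof (rule ccontr)
  assume "\<not> ?thesis"
  then have nbrs: "(c, d) \<in> restricted_conn r S"
    if "c \<notin> S" "d \<notin> S" "(i, c) \<in> r" "(i, d) \<in> r" for c d
    using that by blast
  have "(a, b) \<in> (Restr r (- (S - {i})))\<^sup>*"
    using assms(4) by (auto simp: restricted_conn_def)
  \<comment> \<open>The invariant is generalized to every end of an initial segment of the walk. An
    end in \<open>S\<close> can only be \<open>i\<close>, and then \<open>a\<close> is connected to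
    a neighbour of \<open>i\<close>.\<close>
  then have "if b \<in> S then \<exists>c. c \<notin> S \<and> (i, c) \<in> r \<and> (a, c) \<in> restricted_conn r S
             else (a, b) \<in> restricted_conn r S"
  proof (induction rule: rtrancl_induct)
    case base
    then show ?case using assms(2) by (simp add: restricted_conn_refl)
  next
    case (step y z)
    have yz: "(y, z) \<in> r" "(z, y) \<in> r" and "y \<notin> S \<or> y = i" "z \<notin> S \<or> z = i"
      using step(2) assms(1) by (auto dest: symD)
    then consider "y \<notin> S" "z \<notin> S" | "y \<notin> S" "z \<in> S" "z = i"
      | "y \<in> S" "y = i" "z \<notin> S" | "y \<in> S" "z \<in> S" "y = i" "z = i"
      by blast
    then show ?case
    proof cases
      case 1
      then show ?thesis
        using step(3) restricted_conn_edge[OF yz(1)] restricted_conn_trans by (metis (full_types))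
    next
      case 2
      then show ?thesis
        using step(3) yz by auto
    next
      case 3
      then show ?thesis
        using step(3) yz nbrs restricted_conn_trans by (metis (full_types))
    next
      case 4
      then show ?thesis
        using step(3) by auto
    qed
  qed
  with assms(3,5) show False by simp
qed

text \<open>Each component outside \<open>S\<close> lies in one component after \<open>i\<close> is
  returned. If no pair is newly joined, this map is injective and the count cannot drop; if some
  pair is, the map is surjective but not injective.\<close>

lemma card_components_less_iff:
  fixes r :: "'v::finite rel"
  assumes "sym r" and "i \<in> S"
  shows "card ((- (S - {i})) // restricted_conn r (S - {i})) < card ((- S) // restricted_conn r S) \<longleftrightarrow>
    (\<exists>a b. a \<notin> S \<and> b \<notin> S \<and> (a, b) \<in> restricted_conn r (S - {i}) \<and> (a, b) \<notin> restricted_conn r S)"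
    (is "card (?A' // ?R') < card (?A // ?R) \<longleftrightarrow> ?ex")
proof -
  have eq: "equiv ?A ?R" "equiv ?A' ?R'"
    by (rule equiv_restricted_conn[OF assms(1)])+
  have sub: "?R \<subseteq> ?R'"
    by (rule restricted_conn_mono) auto
  let ?f = "\<lambda>C. ?R' `` C"
  have f: "?f (?R `` {a}) = ?R' `` {a}" if "a \<notin> S" for a
    using that sub restricted_conn_refl[OF that, of r]
    by (auto intro: restricted_conn_trans)
  have f_sub: "?f ` (?A // ?R) \<subseteq> ?A' // ?R'"
    by (auto simp: f elim!: quotientE intro!: quotientI)
  show ?thesis
  proof
    assume less: "card (?A' // ?R') < card (?A // ?R)"
    show ?ex
    proof (rule ccontr)
      assume "\<not> ?ex"
      then have "(a, b) \<in> ?R" if "a \<notin> S" "b \<notin> S" "(a, b) \<in> ?R'" for a b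
        using that by blast
      note sub' = this
      have "inj_on ?f (?A // ?R)"
      proof (rule inj_onI, elim quotientE)
        fix C D a b
        assume *: "?f C = ?f D" "a \<in> ?A" "C = ?R `` {a}" "b \<in> ?A" "D = ?R `` {b}"
        then have "?R' `` {a} = ?R' `` {b}"
          by (simp add: f)
        with * have "(a, b) \<in> ?R'"
          by (auto simp: eq_equiv_class_iff[OF eq(2)])
        with * sub' show "C = D"
          by (simp add: equiv_class_eq[OF eq(1)])
      qed
      then have "card (?A // ?R) \<le> card (?A' // ?R')"
        using f_sub by (rule card_inj_on_le) simp
      with less show False by simp
    qed
  next
    assume ?ex
    then obtain a b where ab: "a \<notin> S" "b \<notin> S" "(a, b) \<in> ?R'" "(a, b) \<notin> ?R"
      by blast
    from restricted_conn_cut_neighbours[OF assms(1) this] obtain c where c: "c \<notin> S" "(i, c) \<in> r"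
      by blast
    then have ic: "(i, c) \<in> ?R'"
      by (intro restricted_conn_edge) auto
    \<comment> \<open>The class of \<open>i\<close> is also that of its neighbour \<open>c\<close>,
      so every class has a representative outside \<open>S\<close>.\<close>
    have "?A' // ?R' \<subseteq> ?f ` (?A // ?R)"
    proof
      fix C assume "C \<in> ?A' // ?R'"
      then obtain x where x: "x \<in> ?A'" "C = ?R' `` {x}"
        by (rule quotientE)
      obtain y where "y \<notin> S" "C = ?R' `` {y}"
        using x c(1) equiv_class_eq[OF eq(2) ic] by (cases "x = i") auto
      then show "C \<in> ?f ` (?A // ?R)"
        by (metis ComplI f imageI quotientI)
    qed
    with f_sub have surj: "?f ` (?A // ?R) = ?A' // ?R'"
      by blast
    have "\<not> inj_on ?f (?A // ?R)"
    proof
      assume "inj_on ?f (?A // ?R)"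
      moreover have "?f (?R `` {a}) = ?f (?R `` {b})"
        using ab f equiv_class_eq[OF eq(2)] by metis
      moreover have "?R `` {a} \<in> ?A // ?R" "?R `` {b} \<in> ?A // ?R"
        using ab by (auto intro: quotientI)
      ultimately have "?R `` {a} = ?R `` {b}"
        by (rule inj_onD)
      then show False
        using ab eq_equiv_class[OF _ eq(1), of a b] by auto
    qed
    then have "card (?f ` (?A // ?R)) \<noteq> card (?A // ?R)"
      using eq_card_imp_inj_on[of "?A // ?R" ?f] by auto
    moreover have "card (?f ` (?A // ?R)) \<le> card (?A // ?R)"
      by (rule card_image_le) simp
    ultimately show "card (?A' // ?R') < card (?A // ?R)"
      unfolding surj by (rule le_neq_implies_less[rotated])
  qed
qed

section \<open>Cuts and ideals of the graph in terms of relations\<close>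

definition edge_rel :: "'v set set \<Rightarrow> 'v rel" where
  "edge_rel E = {(i, j). {i, j} \<in> E}"

lemma sym_edge_rel: "sym (edge_rel E)"
  by (auto simp: sym_def edge_rel_def insert_commute)

lemma induced_components_eq:
  "induced_components E (UNIV - S) = (- S) // restricted_conn (edge_rel E) S"
proof -
  have "induced_adj E (UNIV - S) = Restr (edge_rel E) (- S)"
    by (auto simp: induced_adj_def edge_rel_def)
  then show ?thesis
    by (simp add: induced_components_def restricted_conn_def Compl_eq_Diff_UNIV)
qed

lemma same_component_iff:
  "(\<exists>V\<in>induced_components E (UNIV - S). i \<in> V \<and> j \<in> V) \<longleftrightarrow> (i, j) \<in> restricted_conn (edge_rel E) S"
  (is "?L \<longleftrightarrow> (i, j) \<in> ?R")
proof
  assume ?L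
  then obtain V where "V \<in> (- S) // ?R" "i \<in> V" "j \<in> V"
    by (auto simp: induced_components_eq)
  then show "(i, j) \<in> ?R"
    using in_quotient_imp_in_rel[OF equiv_restricted_conn[OF sym_edge_rel]] by (metis empty_subsetI insert_subset)
next
  assume *: "(i, j) \<in> ?R"
  then have "i \<notin> S"
    by (auto simp: restricted_conn_def)
  then have "?R `` {i} \<in> (- S) // ?R" "i \<in> ?R `` {i}" "j \<in> ?R `` {i}"
    using * by (auto simp: restricted_conn_refl intro: quotientI)
  then show ?L
    unfolding induced_components_eq by blast
qed

lemma cut_point_iff:
  fixes E :: "'v::finite set set"
  assumes "i \<in> S"
  shows "cut_point E ((UNIV - S) \<union> {i}) i \<longleftrightarrow>
    (\<exists>a b. a \<notin> S \<and> b \<notin> S \<and> (a, b) \<in> restricted_conn (edge_rel E) (S - {i}) \<and>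
       (a, b) \<notin> restricted_conn (edge_rel E) S)"
proof -
  have *: "(UNIV - S) \<union> {i} = UNIV - (S - {i})" "UNIV - (S - {i}) - {i} = UNIV - S"
    using assms by auto
  show ?thesis
    unfolding cut_point_def * induced_components_eq card_components_less_iff[OF sym_edge_rel assms]
    by simp
qed

text \<open>The bound on \<open>k\<close> is automatic for nonempty \<open>S\<close>: a cut point
  makes the count exceed that of a nonempty graph, which is at least 1. The empty set satisfies the
  condition vacuously.\<close>

lemma min_cuts_eq:
  fixes E :: "'v::finite set set"
  shows "min_cuts E = {S. \<forall>i\<in>S. cut_point E ((UNIV - S) \<union> {i}) i}"
proof -
  have "\<exists>k\<ge>2. minimal_cut E k S"
    if "i \<in> S" and cut: "\<forall>i\<in>S. cut_point E ((UNIV - S) \<union> {i}) i" for S i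
  proof -
    have "cut_point E ((UNIV - S) \<union> {i}) i"
      using that by blast
    moreover have "S \<subset> UNIV"
      using calculation cut_point_iff[OF \<open>i \<in> S\<close>, of E] by auto
    moreover have "induced_components E ((UNIV - S) \<union> {i}) \<noteq> {}"
      by (simp add: induced_components_def quotient_def)
    then have "0 < card (induced_components E ((UNIV - S) \<union> {i}))"
      by (simp add: card_gt_0_iff)
    moreover have "UNIV - S \<union> {i} - {i} = UNIV - S"
      using \<open>i \<in> S\<close> by auto
    ultimately have "2 \<le> card (induced_components E (UNIV - S))"
      by (simp add: cut_point_def)
    with that \<open>S \<subset> UNIV\<close> show ?thesis
      by (auto simp: minimal_cut_def)
  qed
  then show ?thesis
    unfolding min_cuts_def by (auto simp: minimal_cut_def)
qed

lemma binomial_edge_ideal_eq: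
  fixes E :: "'v::{finite,linorder} set set"
  shows "binomial_edge_ideal E = minor_ideal {} (edge_rel E)"
proof -
  let ?G = "{minor i j | i j. {i, j} \<in> E \<and> i < j}" and ?K = "{minor i j | i j. (i, j) \<in> edge_rel E}"
  have "minor i j \<in> ideal_span ?G" if "{i, j} \<in> E" for i j
  proof (cases i j rule: linorder_cases)
    case less
    with that show ?thesis by (intro ideal_span_base) blast
  next
    case equal
    then show ?thesis by (simp add: minor_def ideal_span_zero)
  next
    case greater
    moreover have "{j, i} \<in> E"
      using that by (simp add: insert_commute)
    ultimately have "minor j i \<in> ideal_span ?G"
      by (intro ideal_span_base) blast
    then show ?thesis
      unfolding minor_commute[of i j] by (rule ideal_span_neg)
  qed
  then have "?K \<subseteq> ideal_span ?G"
    by (auto simp: edge_rel_def)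
  moreover have "?G \<subseteq> ideal_span ?K"
    by (auto simp: edge_rel_def intro!: ideal_span_base)
  ultimately have "ideal_span ?G = ideal_span ?K"
    by (simp add: ideal_span_subset_iff set_eq_subset)
  then show ?thesis
    by (simp add: binomial_edge_ideal_def genideal_xy_ring minor_ideal_def)
qed

text \<open>With \<open>i < j\<close> no generator is a zero minor and the sign is that of
  \<open>transversal_poly\<close>; products in the final argument are formed from these
  generators.\<close>

lemma cut_prime_generators:
  fixes E :: "'v::{finite,linorder} set set"
  shows "cut_prime E S = ideal_span (xvar ` S \<union> yvar ` S \<union>
    {minor i j | i j. i < j \<and> (i, j) \<in> restricted_conn (edge_rel E) S})"
proof -
  have "(\<Union>V\<in>induced_components E (UNIV - S). {minor i j | i j. i < j \<and> i \<in> V \<and> j \<in> V}) =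
      {minor i j | i j. i < j \<and> (i, j) \<in> restricted_conn (edge_rel E) S}"
    unfolding same_component_iff[symmetric] by blast
  then show ?thesis
    by (simp add: cut_prime_def genideal_xy_ring set_add_xy_ring)
qed

lemma cut_prime_eq:
  fixes E :: "'v::{finite,linorder} set set"
  shows "cut_prime E S = conn_ideal (edge_rel E) S"
proof -
  let ?R = "restricted_conn (edge_rel E) S"
  have "minor i j \<in> cut_prime E S" if "(i, j) \<in> ?R" for i j
  proof (cases i j rule: linorder_cases)
    case less
    with that show ?thesis unfolding cut_prime_generators by (intro ideal_span_base) blast
  next
    case equal
    then show ?thesis by (simp add: cut_prime_generators minor_def ideal_span_zero)
  next
    case greater
    with that have "minor j i \<in> cut_prime E S"
      unfolding cut_prime_generators using restricted_conn_sym[OF sym_edge_rel that]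
      by (intro ideal_span_base) blast
    then show ?thesis
      unfolding cut_prime_generators minor_commute[of i j] by (rule ideal_span_neg)
  qed
  then have "conn_ideal (edge_rel E) S \<subseteq> cut_prime E S"
    unfolding cut_prime_generators minor_ideal_subset_iff by (auto intro: ideal_span_base)
  moreover have "cut_prime E S \<subseteq> conn_ideal (edge_rel E) S"
    unfolding cut_prime_generators minor_ideal_def by (rule ideal_span_mono) blast
  ultimately show ?thesis by blast
qed

text \<open>A vertex of \<open>S\<close> that is not a cut point can be returned to the graph
  without leaving P_S; repeating this ends at a minimal cut.\<close>

lemma cut_prime_superset_min_cut:
  fixes E :: "'v::{finite,linorder} set set"
  shows "\<exists>S'\<in>min_cuts E. cut_prime E S' \<subseteq> cut_prime E S"
proof (induction "card S" arbitrary: S rule: less_induct)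
  case less
  show ?case
  proof (cases "S \<in> min_cuts E")
    case False
    then obtain i where i: "i \<in> S" "\<not> cut_point E ((UNIV - S) \<union> {i}) i"
      by (auto simp: min_cuts_eq)
    have "card (S - {i}) < card S"
      using i(1) by (intro psubset_card_mono) auto
    from less[OF this] obtain S' where S': "S' \<in> min_cuts E" "cut_prime E S' \<subseteq> cut_prime E (S - {i})"
      by blast
    \<comment> \<open>If \<open>a\<close> or \<open>b\<close> is \<open>i\<close>, the minor is in
      P_S because \<open>i\<close> is in \<open>S\<close>; otherwise \<open>a\<close> and
      \<open>b\<close> were connected before \<open>i\<close> was returned.\<close>
    have "minor a b \<in> cut_prime E S" if "(a, b) \<in> restricted_conn (edge_rel E) (S - {i})" for a b
      using that i unfolding cut_prime_eq minor_in_conn_ideal_iff[OF sym_edge_rel] cut_point_iff[OF i(1)]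
      by blast
    then have "cut_prime E (S - {i}) \<subseteq> cut_prime E S"
      unfolding cut_prime_eq[of E "S - {i}"] unfolding cut_prime_generators minor_ideal_subset_iff
      by (auto intro: ideal_span_base)
    with S' show ?thesis by blast
  qed blast
qed

section \<open>Prime decomposition of J_G and the colon ideal\<close>

lemma binomial_edge_ideal_eq_Inter:
  fixes E :: "'v::{finite,linorder} set set"
  shows "binomial_edge_ideal E = (\<Inter>S\<in>min_cuts E. cut_prime E S)"
proof
  have "minor i j \<in> conn_ideal (edge_rel E) S" if "(i, j) \<in> edge_rel E" for i j S
    using that restricted_conn_edge[of i j "edge_rel E" S]
    unfolding minor_in_conn_ideal_iff[OF sym_edge_rel] by blast
  then have "binomial_edge_ideal E \<subseteq> conn_ideal (edge_rel E) S" for S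
    by (auto simp: binomial_edge_ideal_eq minor_ideal_subset_minor_ideal_iff)
  then show "binomial_edge_ideal E \<subseteq> (\<Inter>S\<in>min_cuts E. cut_prime E S)"
    unfolding cut_prime_eq by blast
next
  show "(\<Inter>S\<in>min_cuts E. cut_prime E S) \<subseteq> binomial_edge_ideal E"
  proof
    fix p assume p: "p \<in> (\<Inter>S\<in>min_cuts E. cut_prime E S)"
    \<comment> \<open>Every P_T contains the prime of a minimal cut, so \<open>p\<close> lies in all
      of them and the completion result applies with empty starting set.\<close>
    have all: "p \<in> conn_ideal (edge_rel E) T" for T
      using p cut_prime_superset_min_cut[of E T] unfolding cut_prime_eq by blast
    show "p \<in> binomial_edge_ideal E"
      unfolding binomial_edge_ideal_eq
      by (rule in_minor_ideal_if_in_all_conn_ideals[OF sym_edge_rel all])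
  qed
qed

text \<open>The variables force \<open>S \<subseteq> S'\<close>. A vertex \<open>i\<close> of
  \<open>S'\<close> outside \<open>S\<close> has neighbours \<open>c\<close>, \<open>d\<close> in
  different components outside \<open>S'\<close>; outside \<open>S\<close> they are joined through
  \<open>i\<close>, so f_cd is in P_S but not in P_{S'}.\<close>

lemma cut_prime_incomparable:
  fixes E :: "'v::{finite,linorder} set set"
  assumes "S' \<in> min_cuts E" and sub: "cut_prime E S \<subseteq> cut_prime E S'"
  shows "S = S'"
proof (rule ccontr)
  assume "S \<noteq> S'"
  moreover have "S \<subseteq> S'"
    using sub xvar_in_conn_ideal_iff[OF sym_edge_rel[of E]] unfolding cut_prime_eq by blast
  ultimately obtain i where i: "i \<in> S'" "i \<notin> S"
    by blast
  then have "cut_point E ((UNIV - S') \<union> {i}) i"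
    using assms(1) by (auto simp: min_cuts_eq)
  then obtain a b where "a \<notin> S'" "b \<notin> S'" "(a, b) \<in> restricted_conn (edge_rel E) (S' - {i})"
    "(a, b) \<notin> restricted_conn (edge_rel E) S'"
    unfolding cut_point_iff[OF i(1)] by blast
  from restricted_conn_cut_neighbours[OF sym_edge_rel this] obtain c d where cd: "c \<notin> S'" "d \<notin> S'"
    "(i, c) \<in> edge_rel E" "(i, d) \<in> edge_rel E" "(c, d) \<notin> restricted_conn (edge_rel E) S'"
    by blast
  have "(i, c) \<in> restricted_conn (edge_rel E) S" "(i, d) \<in> restricted_conn (edge_rel E) S"
    using cd i \<open>S \<subseteq> S'\<close> by (auto intro!: restricted_conn_edge)
  then have "(c, d) \<in> restricted_conn (edge_rel E) S"
    by (metis restricted_conn_sym restricted_conn_trans sym_edge_rel)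
  then have "minor c d \<in> cut_prime E S'"
    unfolding cut_prime_eq by (rule subsetD[OF sub[unfolded cut_prime_eq] minor_in_minor_ideal])
  with cd show False
    by (simp add: cut_prime_eq minor_in_conn_ideal_iff[OF sym_edge_rel])
qed

text \<open>Incomparability supplies an element of P_S outside P_{S'}, and primality cancels it.
  Conversely a product with a factor in P_S and a factor in all other primes lies in every
  prime.\<close>

lemma ideal_quotient_cut_prime:
  fixes E :: "'v::{finite,linorder} set set"
  assumes "S \<in> min_cuts E"
  shows "ideal_quotient xy_ring (binomial_edge_ideal E) (cut_prime E S) =
    (\<Inter>S'\<in>min_cuts E - {S}. cut_prime E S')"
proof
  show "ideal_quotient xy_ring (binomial_edge_ideal E) (cut_prime E S) \<subseteq>
      (\<Inter>S'\<in>min_cuts E - {S}. cut_prime E S')"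
  proof
    fix p assume p: "p \<in> ideal_quotient xy_ring (binomial_edge_ideal E) (cut_prime E S)"
    show "p \<in> (\<Inter>S'\<in>min_cuts E - {S}. cut_prime E S')"
    proof
      fix S' assume S': "S' \<in> min_cuts E - {S}"
      then obtain a where a: "a \<in> cut_prime E S" "a \<notin> cut_prime E S'"
        using cut_prime_incomparable[of S' E S] by blast
      then have "p * a \<in> cut_prime E S'"
        using p S' by (auto simp: ideal_quotient_def binomial_edge_ideal_eq_Inter)
      with a(2) show "p \<in> cut_prime E S'"
        unfolding cut_prime_eq using conn_ideal_prime[OF sym_edge_rel] by blast
    qed
  qed
next
  show "(\<Inter>S'\<in>min_cuts E - {S}. cut_prime E S') \<subseteq>
      ideal_quotient xy_ring (binomial_edge_ideal E) (cut_prime E S)"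
    unfolding binomial_edge_ideal_eq_Inter cut_prime_eq ideal_quotient_def
    by (auto intro: minor_ideal_mult_left minor_ideal_mult_right)
qed

section \<open>Transversals\<close>

lemma singleton_dependent_iff: "{i} \<in> dependent_sets E S \<longleftrightarrow> i \<in> S"
proof -
  have "\<not> 2 \<le> card ({i} \<inter> V)" for V
    using card_mono[of "{i}" "{i} \<inter> V"] by simp
  then show ?thesis
    by (simp add: dependent_sets_def)
qed

text \<open>The right side is that of \<open>minor_in_conn_ideal_iff\<close>: a pair is dependent
  exactly when its minor lies in P_S, just as a singleton is when its variables do.\<close>

lemma pair_dependent_iff:
  assumes "i \<noteq> j"
  shows "{i, j} \<in> dependent_sets E S \<longleftrightarrow> i \<in> S \<or> j \<in> S \<or> (i, j) \<in> restricted_conn (edge_rel E) S"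
proof -
  have "2 \<le> card ({i, j} \<inter> V) \<longleftrightarrow> i \<in> V \<and> j \<in> V" for V
    using assms by (cases "i \<in> V"; cases "j \<in> V") (auto simp: Int_insert_left)
  moreover have "\<not> 3 \<le> card {i, j}"
    using assms by simp
  ultimately show ?thesis
    unfolding same_component_iff[symmetric] dependent_sets_def by auto
qed

text \<open>Sets of three or more elements are dependent for every cut and the empty set for none,
  so neither survives in a difference.\<close>

lemma dependency_difference_cases:
  fixes E :: "'v::finite set set"
  assumes "B \<in> dependent_sets E S' - dependent_sets E S"
  obtains i where "B = {i}" | i j where "B = {i, j}" "i \<noteq> j"
proof -
  have "\<not> 3 \<le> card B"
    using assms by (auto simp: dependent_sets_def)
  moreover have "B \<noteq> {}"
    using assms by (auto simp: dependent_sets_def)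
  then have "card B \<noteq> 0"
    by simp
  ultimately have "card B = 1 \<or> card B = 2"
    by linarith
  then show ?thesis
    using that by (auto simp: card_1_singleton_iff card_2_iff)
qed

text \<open>The transversal contains a set \<open>B\<close> dependent for \<open>S'\<close>, and the
  factor contributed by \<open>B\<close> lies in P_{S'}.\<close>

lemma transversal_poly_in_cut_prime:
  fixes E :: "'v::{finite,linorder} set set"
  assumes "A \<in> cut_transversals E S" and "C \<union> D = singleton_part A" and "S' \<in> min_cuts E - {S}"
  shows "transversal_poly A C D \<in> cut_prime E S'"
proof -
  have "dependent_sets E S' - dependent_sets E S \<in> dependency_differences E S"
    using assms(3) unfolding dependency_differences_def by blast
  then obtain B where B: "B \<in> A" "B \<in> dependent_sets E S' - dependent_sets E S"
    using assms(1) unfolding cut_transversals_def transversals_def by blast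
  have "\<exists>g\<in>cut_prime E S'. g dvd transversal_poly A C D"
    using B(2)
  proof (cases rule: dependency_difference_cases)
    case (1 i)
    then have "i \<in> S'" "i \<in> C \<or> i \<in> D"
      using B assms(2) by (auto simp: singleton_dependent_iff singleton_part_def)
    then show ?thesis
    proof (elim disjE)
      assume "i \<in> C"
      then have "xvar i dvd (\<Prod>k\<in>C. xvar k)"
        by (intro dvd_prodI) simp_all
      then have "xvar i dvd transversal_poly A C D"
        by (simp add: transversal_poly_def)
      with \<open>i \<in> S'\<close> show ?thesis
        unfolding cut_prime_eq by (blast intro: xvar_in_minor_ideal)
    next
      assume "i \<in> D"
      then have "yvar i dvd (\<Prod>k\<in>D. yvar k)"
        by (intro dvd_prodI) simp_all
      then have "yvar i dvd transversal_poly A C D"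
        by (simp add: transversal_poly_def)
      with \<open>i \<in> S'\<close> show ?thesis
        unfolding cut_prime_eq by (blast intro: yvar_in_minor_ideal)
    qed
  next
    case (2 i j)
    have "minor (Min B) (Max B) dvd (\<Prod>e\<in>pair_part A. minor (Min e) (Max e))"
      using 2 B(1) by (intro dvd_prodI) (auto simp: pair_part_def)
    then have "minor (Min B) (Max B) dvd transversal_poly A C D"
      by (simp add: transversal_poly_def)
    moreover have "Min B \<noteq> Max B" "B = {Min B, Max B}"
      using 2 by (auto simp: min_def max_def)
    then have "minor (Min B) (Max B) \<in> cut_prime E S'"
      using B(2) pair_dependent_iff[of "Min B" "Max B" E S']
      unfolding cut_prime_eq minor_in_conn_ideal_iff[OF sym_edge_rel] by auto
    ultimately show ?thesis by blast
  qed
  then show ?thesis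
    unfolding cut_prime_generators using ideal_span_dvd by blast
qed

text \<open>Each factor is labelled by its vertex or pair, which is dependent for \<open>s\<close>
  but not for \<open>S\<close>; hence the labels form a transversal.\<close>

lemma prod_generators_dvd:
  fixes E :: "'v::{finite,linorder} set set" and S :: "'v set"
  defines "H \<equiv> min_cuts E - {S}"
  assumes g: "\<And>s. s \<in> H \<Longrightarrow>
      g s \<in> xvar ` s \<union> yvar ` s \<union> {minor i j | i j. i < j \<and> (i, j) \<in> restricted_conn (edge_rel E) s}"
    and g_notin: "\<And>s. s \<in> H \<Longrightarrow> g s \<notin> cut_prime E S"
  obtains A C D where "A \<in> cut_transversals E S" "C \<union> D = singleton_part A" "C \<inter> D = {}"
    "transversal_poly A C D dvd (\<Prod>s\<in>H. g s)"
proof -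
  define label where "label B p \<longleftrightarrow>
    (\<exists>i. B = {i} \<and> (p = xvar i \<or> p = yvar i)) \<or> (\<exists>i j. i < j \<and> B = {i, j} \<and> p = minor i j)"
    for B :: "'v set" and p
  have "\<exists>B. B \<in> dependent_sets E s - dependent_sets E S \<and> label B (g s)" if s: "s \<in> H" for s
  proof -
    consider i where "i \<in> s" "g s = xvar i \<or> g s = yvar i"
      | i j where "i < j" "(i, j) \<in> restricted_conn (edge_rel E) s" "g s = minor i j"
      using g[OF s] by blast
    then show ?thesis
    proof cases
      case (1 i)
      then have "i \<notin> S"
        using g_notin[OF s] xvar_in_minor_ideal yvar_in_minor_ideal unfolding cut_prime_eq by metis
      with 1 show ?thesis
        by (intro exI[of _ "{i}"]) (auto simp: singleton_dependent_iff label_def)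
    next
      case (2 i j)
      then have "{i, j} \<notin> dependent_sets E S"
        using g_notin[OF s] unfolding cut_prime_eq
        by (simp add: pair_dependent_iff minor_in_conn_ideal_iff[OF sym_edge_rel])
      with 2 show ?thesis
        by (intro exI[of _ "{i, j}"]) (auto simp: pair_dependent_iff label_def)
    qed
  qed
  then obtain B where B: "\<And>s. s \<in> H \<Longrightarrow> B s \<in> dependent_sets E s - dependent_sets E S"
    "\<And>s. s \<in> H \<Longrightarrow> label (B s) (g s)"
    by metis
  define A where "A = B ` H"
  \<comment> \<open>Several cuts may share a label, so one is chosen per label; the factors of the
    others are dropped, which leaves divisibility instead of equality.\<close>
  define \<tau> where "\<tau> = inv_into H B"
  have \<tau>: "\<tau> b \<in> H" "B (\<tau> b) = b" if "b \<in> A" for b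
    using that by (auto simp: \<tau>_def A_def inv_into_into f_inv_into_f)
  \<comment> \<open>A singleton label \<open>{i}\<close> may come with x_i or y_i; the factor at the
    chosen cut decides between \<open>C\<close> and \<open>D\<close>.\<close>
  define C where "C = {i. {i} \<in> A \<and> g (\<tau> {i}) = xvar i}"
  define D where "D = {i. {i} \<in> A \<and> g (\<tau> {i}) \<noteq> xvar i}"
  have lab: "label b (g (\<tau> b))" if "b \<in> A" for b
    using B(2)[of "\<tau> b"] \<tau>[OF that] by simp
  have gD: "g (\<tau> {i}) = yvar i" if "i \<in> D" for i
    using that lab[of "{i}"] by (auto simp: D_def label_def)
  have gp: "g (\<tau> b) = minor (Min b) (Max b)" if "b \<in> pair_part A" for b
    using that lab[of b] by (auto simp: pair_part_def label_def)
  have "A = (\<lambda>i. {i}) ` C \<union> (\<lambda>i. {i}) ` D \<union> pair_part A"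
    using lab by (fastforce simp: C_def D_def pair_part_def label_def)
  then have "(\<Prod>b\<in>A. g (\<tau> b)) = (\<Prod>b\<in>(\<lambda>i. {i}) ` C \<union> (\<lambda>i. {i}) ` D \<union> pair_part A. g (\<tau> b))"
    by simp
  also have "\<dots> = (\<Prod>b\<in>(\<lambda>i. {i}) ` C. g (\<tau> b)) *
      (\<Prod>b\<in>(\<lambda>i. {i}) ` D. g (\<tau> b)) * (\<Prod>b\<in>pair_part A. g (\<tau> b))"
  proof -
    have "(\<lambda>i. {i}) ` C \<inter> (\<lambda>i. {i}) ` D = {}" "((\<lambda>i. {i}) ` C \<union> (\<lambda>i. {i}) ` D) \<inter> pair_part A = {}"
      by (auto simp: C_def D_def pair_part_def)
    then show ?thesis
      by (subst prod.union_disjoint; simp add: prod.union_disjoint)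
  qed
  also have "\<dots> = transversal_poly A C D"
    unfolding transversal_poly_def by (simp add: prod.reindex gD gp) (simp add: C_def)
  finally have poly: "transversal_poly A C D = (\<Prod>b\<in>A. g (\<tau> b))" ..
  also have "\<dots> = (\<Prod>s\<in>\<tau> ` A. g s)"
  proof -
    have "inj_on \<tau> A"
      using \<tau>(2) by (rule inj_on_inverseI)
    then show ?thesis by (simp add: prod.reindex)
  qed
  also have "\<dots> dvd (\<Prod>s\<in>H. g s)"
    using \<tau>(1) by (intro prod_dvd_prod_subset) auto
  finally have "transversal_poly A C D dvd (\<Prod>s\<in>H. g s)" .
  moreover have "A \<in> cut_transversals E S"
  proof -
    have differences: "dependency_differences E S = (\<lambda>s. dependent_sets E s - dependent_sets E S) ` H"
      by (auto simp: dependency_differences_def H_def)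
    show ?thesis
      unfolding cut_transversals_def transversals_def differences A_def using B(1) by blast
  qed
  moreover have "C \<union> D = singleton_part A" "C \<inter> D = {}"
    by (auto simp: C_def D_def singleton_part_def)
  ultimately show thesis
    using that by blast
qed

section \<open>The colon ideal as a radical\<close>

theorem theorem3p3:
  fixes E :: "'v::{finite,linorder} set set" and S :: "'v set"
  assumes "simple_graph E" and "connected_graph E" and "S \<in> min_cuts E"
  shows "ideal_quotient xy_ring (binomial_edge_ideal E) (cut_prime E S) =
    ideal_radical xy_ring
      (binomial_edge_ideal E <+>\<^bsub>xy_ring\<^esub>
       Idl\<^bsub>xy_ring\<^esub> {transversal_poly A C D | A C D.
         A \<in> cut_transversals E S \<and> C \<union> D = singleton_part A \<and> C \<inter> D = {}})"
proof -
  define H where "H = min_cuts E - {S}"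
  define G where "G = {transversal_poly A C D | A C D.
         A \<in> cut_transversals E S \<and> C \<union> D = singleton_part A \<and> C \<inter> D = {}}"
  define J where "J = binomial_edge_ideal E"
  have J: "J = ideal_span J"
    unfolding J_def binomial_edge_ideal_eq minor_ideal_def by (simp only: ideal_span_span)
  have sum: "J <+>\<^bsub>xy_ring\<^esub> Idl\<^bsub>xy_ring\<^esub> G = ideal_span (J \<union> G)"
    using set_add_xy_ring[of J G] J by (simp add: genideal_xy_ring)
  have "(\<Inter>s\<in>H. cut_prime E s) = ideal_radical xy_ring (ideal_span (J \<union> G))"
  proof
    show "(\<Inter>s\<in>H. cut_prime E s) \<subseteq> ideal_radical xy_ring (ideal_span (J \<union> G))"
    proof
      fix p assume p: "p \<in> (\<Inter>s\<in>H. cut_prime E s)"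
      let ?gens = "\<lambda>s. xvar ` s \<union> yvar ` s \<union>
        {minor i j | i j. i < j \<and> (i, j) \<in> restricted_conn (edge_rel E) s}"
      let ?prods = "{\<Prod>s\<in>H. g s | g. \<forall>s\<in>H. g s \<in> ?gens s}"
      have "p ^ card H \<in> ideal_span ?prods"
        using p by (intro power_card_in_ideal_span_prod) (auto simp: cut_prime_generators)
      also have "ideal_span ?prods \<subseteq> ideal_span (J \<union> G)"
        unfolding ideal_span_subset_iff
      proof clarify
        fix g assume g: "\<forall>s\<in>H. g s \<in> ?gens s"
        show "(\<Prod>s\<in>H. g s) \<in> ideal_span (J \<union> G)"
        \<comment> \<open>With a factor in P_S the product lies in every prime, since each other P_s
          contains its own factor \<open>g s\<close>; hence it lies in \<open>J\<close>.\<close>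
        proof (cases "\<exists>s\<in>H. g s \<in> cut_prime E S")
          case True
          have dvd: "g s dvd (\<Prod>s\<in>H. g s)" if "s \<in> H" for s
            using that by (intro dvd_prodI) simp_all
          have "(\<Prod>s\<in>H. g s) \<in> cut_prime E s" if s: "s \<in> min_cuts E" for s
          proof (cases "s = S")
            case True
            with \<open>\<exists>s\<in>H. g s \<in> cut_prime E S\<close> dvd show ?thesis
              unfolding cut_prime_generators using ideal_span_dvd by blast
          next
            case False
            with s have "s \<in> H" by (simp add: H_def)
            with g have "g s \<in> cut_prime E s"
              unfolding cut_prime_generators by (intro ideal_span_base) blast
            with dvd[OF \<open>s \<in> H\<close>] show ?thesis
              unfolding cut_prime_generators using ideal_span_dvd by blast
          qed
          then have "(\<Prod>s\<in>H. g s) \<in> J"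
            by (simp add: J_def binomial_edge_ideal_eq_Inter)
          then show ?thesis
            by (intro ideal_span_base) blast
        next
          case False
          obtain A C D where "A \<in> cut_transversals E S" "C \<union> D = singleton_part A" "C \<inter> D = {}"
            and dvd: "transversal_poly A C D dvd (\<Prod>s\<in>H. g s)"
            by (rule prod_generators_dvd[of E S g, folded H_def]) (use g False in blast)+
          then have "transversal_poly A C D \<in> G"
            by (auto simp: G_def)
          then have "transversal_poly A C D \<in> ideal_span (J \<union> G)"
            by (intro ideal_span_base) blast
          then show ?thesis
            using dvd by (rule ideal_span_dvd)
        qed
      qed
      \<comment> \<open>The radical asks for a positive exponent, and \<open>H\<close> may be
        empty.\<close>
      finally have "p ^ Suc (card H) \<in> ideal_span (J \<union> G)"
        unfolding power_Suc by (rule ideal_span_scale)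
      then show "p \<in> ideal_radical xy_ring (ideal_span (J \<union> G))"
        unfolding ideal_radical_def by (auto intro!: exI[of _ "Suc (card H)"] simp del: power_Suc)
    qed
    show "ideal_radical xy_ring (ideal_span (J \<union> G)) \<subseteq> (\<Inter>s\<in>H. cut_prime E s)"
    proof
      fix p assume "p \<in> ideal_radical xy_ring (ideal_span (J \<union> G))"
      then obtain k :: nat where k: "0 < k" "p ^ k \<in> ideal_span (J \<union> G)"
        by (auto simp: ideal_radical_def)
      show "p \<in> (\<Inter>s\<in>H. cut_prime E s)"
      proof
        fix s assume s: "s \<in> H"
        \<comment> \<open>All generators lie in P_s, and a prime ideal containing a positive power
          of \<open>p\<close> contains \<open>p\<close>.\<close>
        have "J \<union> G \<subseteq> cut_prime E s"
          using s transversal_poly_in_cut_prime[of _ E S]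
          by (auto simp: J_def G_def H_def binomial_edge_ideal_eq_Inter)
        then have "ideal_span (J \<union> G) \<subseteq> cut_prime E s"
          by (simp add: cut_prime_generators ideal_span_subset_iff)
        with k(2) have "p ^ k \<in> cut_prime E s"
          by blast
        then show "p \<in> cut_prime E s"
          unfolding cut_prime_eq using conn_ideal_power[OF sym_edge_rel _ k(1)] by blast
      qed
    qed
  qed
  then show ?thesis
    unfolding ideal_quotient_cut_prime[OF assms(3)] sum[unfolded J_def G_def] H_def J_def G_def .
qed

end
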